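(* Let $a_1, \dots, a_n \in \mathbb{Z}_{>1}$ and, for each $i$, let $a_i^\mathbb{N} = \{a_i^j : j \in \mathbb{N}\}$. Then the structure $(\mathbb{Z}, <, +, a_1^\mathbb{N}, \dots, a_n^\mathbb{N})$ does not define the multiplication function $\cdot : \mathbb{Z}^2 \to \mathbb{Z}$.
   Context: $\mathbb{N}$ denotes the nonnegative integers (including $0$). "Define" means definable by a first-order formula without parameters (in this structure every integer constant is definable, so parameters make no difference). *)

theory Defs
  imports Main
begin

text \<open>First-order formulas with equality over the signature of
  \<open>(\<int>, <, +, P\<^sub>0, \<dots>, P\<^sub>n\<^sub>-\<^sub>1)\<close> with unary predicates \<open>P\<^sub>i\<close>. Variables are named by natural
  numbers. The indices of predicate symbols are restricted to \<open>i < n\<close> by \<open>in_language\<close>.\<close>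

datatype trm = Var nat | Add trm trm

datatype fm =
    Equal trm trm
  | Less trm trm
  | Pred nat trm
  | Neg fm
  | Conj fm fm
  | Exists nat fm

primrec vars_trm :: "trm \<Rightarrow> nat set" where
  "vars_trm (Var x) = {x}"
| "vars_trm (Add s t) = vars_trm s \<union> vars_trm t"

primrec free_vars :: "fm \<Rightarrow> nat set" where
  "free_vars (Equal s t) = vars_trm s \<union> vars_trm t"
| "free_vars (Less s t) = vars_trm s \<union> vars_trm t"
| "free_vars (Pred i t) = vars_trm t"
| "free_vars (Neg \<phi>) = free_vars \<phi>"
| "free_vars (Conj \<phi> \<psi>) = free_vars \<phi> \<union> free_vars \<psi>"
| "free_vars (Exists x \<phi>) = free_vars \<phi> - {x}"

primrec in_language :: "nat \<Rightarrow> fm \<Rightarrow> bool" where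
  "in_language n (Equal s t) \<longleftrightarrow> True"
| "in_language n (Less s t) \<longleftrightarrow> True"
| "in_language n (Pred i t) \<longleftrightarrow> i < n"
| "in_language n (Neg \<phi>) \<longleftrightarrow> in_language n \<phi>"
| "in_language n (Conj \<phi> \<psi>) \<longleftrightarrow> in_language n \<phi> \<and> in_language n \<psi>"
| "in_language n (Exists x \<phi>) \<longleftrightarrow> in_language n \<phi>"

primrec eval_trm :: "(nat \<Rightarrow> int) \<Rightarrow> trm \<Rightarrow> int" where
  "eval_trm e (Var x) = e x"
| "eval_trm e (Add s t) = eval_trm e s + eval_trm e t"

primrec sat :: "int set list \<Rightarrow> (nat \<Rightarrow> int) \<Rightarrow> fm \<Rightarrow> bool" where
  "sat Ps e (Equal s t) \<longleftrightarrow> eval_trm e s = eval_trm e t"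
| "sat Ps e (Less s t) \<longleftrightarrow> eval_trm e s < eval_trm e t"
| "sat Ps e (Pred i t) \<longleftrightarrow> eval_trm e t \<in> Ps ! i"
| "sat Ps e (Neg \<phi>) \<longleftrightarrow> \<not> sat Ps e \<phi>"
| "sat Ps e (Conj \<phi> \<psi>) \<longleftrightarrow> sat Ps e \<phi> \<and> sat Ps e \<psi>"
| "sat Ps e (Exists x \<phi>) \<longleftrightarrow> (\<exists>v. sat Ps (e(x := v)) \<phi>)"

text \<open>Parameter-free definability of a set \<open>X \<subseteq> \<int>\<^sup>m\<close>, with tuples as lists of length \<open>m\<close>.
  The value 0 given to variables \<open>\<ge> m\<close> is immaterial, as these are not free in \<open>\<phi>\<close>.\<close>

definition definable :: "int set list \<Rightarrow> nat \<Rightarrow> int list set \<Rightarrow> bool" where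
  "definable Ps m X \<longleftrightarrow>
     (\<exists>\<phi>. in_language (length Ps) \<phi> \<and> free_vars \<phi> \<subseteq> {..<m} \<and>
          X = {xs. length xs = m \<and> sat Ps (\<lambda>i. if i < m then xs ! i else 0) \<phi>})"

definition definable_binary_fun :: "int set list \<Rightarrow> (int \<Rightarrow> int \<Rightarrow> int) \<Rightarrow> bool" where
  "definable_binary_fun Ps f \<longleftrightarrow> definable Ps 3 {[x, y, f x y] | x y. True}"

definition powers :: "int \<Rightarrow> int set" where
  "powers a = {a ^ j | j :: nat. True}"

end

theory Submission
  imports Defs "HOL-Number_Theory.Number_Theory" "HOL-Computational_Algebra.Squarefree"
begin

text \<open>
  Let \<open>E\<close> be the union of the sets of powers. Quantifiers over \<open>\<int>\<close> are eliminated down to parameters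
  from \<open>E\<close> by a back-and-forth argument: whether a formula holds at a tuple \<open>x\<close> depends only on the
  residues of \<open>x\<close> modulo some \<open>M\<close> and on the signs of \<open>\<Sum> c\<^sub>i x\<^sub>i + t\<close>, where the integers \<open>c\<^sub>i\<close> are
  bounded and \<open>t\<close> ranges over sums of at most \<open>K\<close> elements of \<open>\<plusminus>E\<close>. If multiplication were definable, so would
  be divisibility by \<open>p = M + 1\<close>; but \<open>x\<close> and \<open>x + M\<close> are indistinguishable as soon as suitable multiples of
  both lie in one long gap of the set of such sums.

  Long gaps exist because not every integer is a sum of at most \<open>K\<close> elements of \<open>\<plusminus>E\<close>. If \<open>m\<close> is the
  product of the primes \<open>p\<close> with \<open>p - 1 dvd L\<close> that divide no base, then \<open>E\<close> has at most \<open>n L\<close> residues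
  modulo \<open>m\<close>, so it suffices to make \<open>m\<close> larger than a given multiple of \<open>L\<^sup>K\<close>. Averaging over the
  multiples \<open>L\<close> of \<open>3\<^sup>r\<close> reduces this to a Mertens-type lower bound for the primes
  congruent to \<open>1\<close> modulo \<open>3\<^sup>j\<close>, which is Dirichlet's theorem in Shapiro's elementary form. Powers of 3
  are convenient because the only real nonprincipal character is the one modulo 3, for which
  \<open>L(1, \<chi>) \<noteq> 0\<close> is obvious.
\<close>

section \<open>Formulas and sums of powers\<close>

definition signed_sums :: "int set \<Rightarrow> nat \<Rightarrow> int set" where
  "signed_sums E K = {sum_list xs | xs. length xs \<le> K \<and> set xs \<subseteq> E \<union> uminus ` E}"

lemma signed_sumsI: "length xs \<le> K \<Longrightarrow> set xs \<subseteq> E \<union> uminus ` E \<Longrightarrow> sum_list xs \<in> signed_sums E K"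
  by (auto simp: signed_sums_def)

lemma zero_in_signed_sums: "0 \<in> signed_sums E K"
  using signed_sumsI[of "[]"] by simp

lemma signed_sums_mono: "K \<le> K' \<Longrightarrow> t \<in> signed_sums E K \<Longrightarrow> t \<in> signed_sums E K'"
  by (force simp: signed_sums_def)

lemma signed_sums_add:
  assumes "s \<in> signed_sums E K" "t \<in> signed_sums E K'"
  shows "s + t \<in> signed_sums E (K + K')"
proof -
  obtain xs ys where "s = sum_list xs" "length xs \<le> K" "set xs \<subseteq> E \<union> uminus ` E"
    "t = sum_list ys" "length ys \<le> K'" "set ys \<subseteq> E \<union> uminus ` E"
    using assms by (auto simp: signed_sums_def)
  thus ?thesis using signed_sumsI[of "xs @ ys"] by simp
qed

lemma signed_sums_uminus:
  assumes "s \<in> signed_sums E K"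
  shows "- s \<in> signed_sums E K"
proof -
  obtain xs where "s = sum_list xs" "length xs \<le> K" "set xs \<subseteq> E \<union> uminus ` E"
    using assms by (auto simp: signed_sums_def)
  moreover have "sum_list (map uminus xs) = - sum_list xs"
    by (induction xs) auto
  ultimately show ?thesis using signed_sumsI[of "map uminus xs" K E] by force
qed

lemma signed_sums_diff:
  "s \<in> signed_sums E K \<Longrightarrow> t \<in> signed_sums E K' \<Longrightarrow> s - t \<in> signed_sums E (K + K')"
  using signed_sums_add[OF _ signed_sums_uminus, of s E K t K'] by simp

lemma signed_sums_scale_nat: "t \<in> signed_sums E K \<Longrightarrow> int k * t \<in> signed_sums E (k * K)"
proof (induction k)
  case (Suc k)
  then show ?case using signed_sums_add[of t E K "int k * t" "k * K"]
    by (simp add: algebra_simps)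
qed (simp add: zero_in_signed_sums)

lemma signed_sums_scale:
  assumes "t \<in> signed_sums E K" "nat \<bar>k\<bar> * K \<le> K'"
  shows "k * t \<in> signed_sums E K'"
proof (cases "k \<ge> 0")
  case True
  thus ?thesis using signed_sums_scale_nat[OF assms(1), of "nat k"] assms(2) signed_sums_mono by auto
next
  case False
  thus ?thesis using signed_sums_uminus[OF signed_sums_scale_nat[OF assms(1), of "nat (-k)"]] assms(2)
      signed_sums_mono by auto
qed

lemma base_in_signed_sums: "x \<in> E \<Longrightarrow> x \<in> signed_sums E (Suc 0)"
  using signed_sumsI[of "[x]" 1 E] by simp

lemma const_in_signed_sums: "1 \<in> E \<Longrightarrow> nat \<bar>k\<bar> \<le> K \<Longrightarrow> k \<in> signed_sums E K"
  using signed_sums_scale[OF base_in_signed_sums, of 1 E k K] by simp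

text \<open>The use of \<open>sgn\<close> records order and equality in one condition. The bounds
  \<open>C\<close>, \<open>K\<close> and \<open>M\<close> are kept apart because passing a
  quantifier changes each of them in its own way, whereas \<open>N\<close> is fixed once for a whole
  formula, bound variables included.\<close>

definition indist ::
    "nat \<Rightarrow> int set \<Rightarrow> nat \<Rightarrow> nat \<Rightarrow> nat \<Rightarrow> (nat \<Rightarrow> int) \<Rightarrow> (nat \<Rightarrow> int) \<Rightarrow> bool" where
  "indist N E C K M e e' \<longleftrightarrow>
     (\<forall>i<N. [e i = e' i] (mod int M)) \<and>
     (\<forall>c t. (\<forall>i<N. \<bar>c i\<bar> \<le> int C) \<longrightarrow> t \<in> signed_sums E K \<longrightarrow>
        sgn ((\<Sum>i<N. c i * e i) + t) = sgn ((\<Sum>i<N. c i * e' i) + t))"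

lemma indist_cong: "indist N E C K M e e' \<Longrightarrow> i < N \<Longrightarrow> [e i = e' i] (mod int M)"
  by (simp add: indist_def)

lemma indist_sgn:
  "indist N E C K M e e' \<Longrightarrow> (\<And>i. i < N \<Longrightarrow> \<bar>c i\<bar> \<le> int C) \<Longrightarrow> t \<in> signed_sums E K \<Longrightarrow>
     sgn ((\<Sum>i<N. c i * e i) + t) = sgn ((\<Sum>i<N. c i * e' i) + t)"
  by (simp add: indist_def)

lemma indist_mono:
  assumes "indist N E C K M e e'" "C' \<le> C" "K' \<le> K" "M' dvd M"
  shows "indist N E C' K' M' e e'"
  unfolding indist_def
proof (intro conjI allI impI)
  fix i assume "i < N"
  then show "[e i = e' i] (mod int M')"
    using assms(4) indist_cong[OF assms(1)] cong_dvd_modulus of_nat_dvd_iff by blast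
next
  fix c t assume "\<forall>i<N. \<bar>c i\<bar> \<le> int C'" "t \<in> signed_sums E K'"
  then show "sgn ((\<Sum>i<N. c i * e i) + t) = sgn ((\<Sum>i<N. c i * e' i) + t)"
    using assms(2,3) by (intro indist_sgn[OF assms(1)]) (force intro: signed_sums_mono)+
qed

section \<open>Extending indistinguishable valuations by one value\<close>

lemma sgn_eq_int_iffs:
  fixes a b :: int
  assumes "sgn a = sgn b"
  shows "a = 0 \<longleftrightarrow> b = 0" "a < 0 \<longleftrightarrow> b < 0" "a \<le> 0 \<longleftrightarrow> b \<le> 0"
  using assms by (auto simp: sgn_if split: if_splits)

lemma sum_fun_upd_split:
  fixes c e :: "nat \<Rightarrow> int"
  assumes "x < N"
  shows "(\<Sum>i<N. c i * (e(x := v)) i) = c x * v + (\<Sum>i<N. (c(x := 0)) i * e i)"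
proof -
  have "(\<Sum>i<N. c i * (e(x := v)) i) = c x * v + (\<Sum>i\<in>{..<N}-{x}. c i * e i)"
    using assms by (subst sum.remove[of _ x]) auto
  moreover have "(\<Sum>i<N. (c(x := 0)) i * e i) = (\<Sum>i\<in>{..<N}-{x}. c i * e i)"
    using assms by (subst sum.remove[of _ x]) auto
  ultimately show ?thesis by simp
qed

lemma int_set_has_max:
  fixes A :: "int set"
  assumes "a \<in> A" "\<And>x. x \<in> A \<Longrightarrow> x \<le> b"
  obtains m where "m \<in> A" "\<And>x. x \<in> A \<Longrightarrow> x \<le> m"
proof -
  let ?B = "A \<inter> {a..b}"
  have fin: "finite ?B" and ne: "a \<in> ?B" using assms by auto
  have "Max ?B \<in> ?B" using Max_in[OF fin] ne by blast
  moreover have "x \<le> Max ?B" if "x \<in> A" for x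
  proof (cases "x \<ge> a")
    case True
    thus ?thesis using Max_ge[OF fin] that assms(2) by auto
  next
    case False
    thus ?thesis using Max_ge[OF fin ne] by simp
  qed
  ultimately show ?thesis using that by blast
qed

text \<open>Membership of a new value in all cuts is decided by the cut of \<open>Q v\<close> with \<open>Q = C!\<close>.\<close>

lemma indist_fun_updI:
  fixes C K M :: nat and Q :: int
  assumes x: "x < N" and hyp: "indist N E C K M e e'" and v: "[v = v'] (mod int M)"
  assumes Q: "Q = fact C"
  assumes cut: "\<And>d t. (\<And>i. i < N \<Longrightarrow> \<bar>d i\<bar> \<le> Q * int C) \<Longrightarrow> d x = 0 \<Longrightarrow> t \<in> signed_sums E (fact C * K) \<Longrightarrow>
            sgn (Q * v - ((\<Sum>i<N. d i * e i) + t)) = sgn (Q * v' - ((\<Sum>i<N. d i * e' i) + t))"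
  shows "indist N E C K M (e(x := v)) (e'(x := v'))"
  unfolding indist_def
proof (intro conjI allI impI)
  fix i assume "i < N"
  then show "[(e(x := v)) i = (e'(x := v')) i] (mod int M)"
    using v indist_cong[OF hyp] by simp
next
  fix c t assume c: "\<forall>i<N. \<bar>c i\<bar> \<le> int C" and t: "t \<in> signed_sums E K"
  let ?c0 = "c(x := 0)"
  show "sgn ((\<Sum>i<N. c i * (e(x := v)) i) + t) = sgn ((\<Sum>i<N. c i * (e'(x := v')) i) + t)"
  proof (cases "c x = 0")
    case True
    then show ?thesis
      using indist_sgn[OF hyp, of ?c0 t] c t by (simp add: sum_fun_upd_split[OF x] del: fun_upd_apply) simp
  next
    case False
    \<comment> \<open>As \<open>\<bar>c x\<bar> \<le> C\<close>, the coefficient of the new value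
      divides \<open>Q = C!\<close>. Multiplying the form by the cofactor \<open>k\<close>, with a
      sign, turns its sign into a comparison of \<open>Q * v\<close> with a form \<open>d\<close> in
      which \<open>x\<close> does not occur.\<close>
    have "nat \<bar>c x\<bar> dvd fact C" using c x False by (intro dvd_fact) (force simp: nat_le_iff)+
    then obtain k where k: "fact C = nat \<bar>c x\<bar> * k" by (elim dvdE)
    have "Q = int (fact C)" using Q by simp
    hence Qk: "Q = \<bar>c x\<bar> * int k" using k by simp
    have kpos: "k > 0" using k by (metis fact_nonzero gr0I mult_0_right)
    have kQ: "int k \<le> Q" unfolding Qk using False by (simp add: mult_le_cancel_right1 flip: zero_less_abs_iff)
    define d where "d = (\<lambda>i. - sgn (c x) * int k * ?c0 i)"
    define t' where "t' = - sgn (c x) * int k * t"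
    have key: "sgn (c x * w + (\<Sum>i<N. ?c0 i * f i) + t) =
               sgn (c x) * sgn (Q * w - ((\<Sum>i<N. d i * f i) + t'))" for w f
    proof -
      have "(\<Sum>i<N. d i * f i) = - sgn (c x) * int k * (\<Sum>i<N. ?c0 i * f i)"
        unfolding d_def by (simp add: sum_distrib_left mult.assoc)
      moreover have "\<bar>c x\<bar> = sgn (c x) * c x" by (simp add: abs_sgn mult.commute)
      ultimately have "Q * w - ((\<Sum>i<N. d i * f i) + t') =
          sgn (c x) * int k * (c x * w + (\<Sum>i<N. ?c0 i * f i) + t)"
        unfolding Qk t'_def by (simp add: algebra_simps)
      hence "sgn (c x) * sgn (Q * w - ((\<Sum>i<N. d i * f i) + t')) =
         (sgn (c x) * sgn (c x)) * sgn (int k) * sgn (c x * w + (\<Sum>i<N. ?c0 i * f i) + t)"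
        by (simp add: sgn_mult del: sgn_of_nat)
      also have "sgn (c x) * sgn (c x) = 1" using False by (simp add: sgn_if)
      finally show ?thesis using kpos by simp
    qed
    have "\<bar>d i\<bar> \<le> Q * int C" if "i < N" for i
    proof -
      have "\<bar>d i\<bar> = int k * \<bar>?c0 i\<bar>" unfolding d_def using False by (simp add: abs_mult abs_sgn_eq)
      also have "\<dots> \<le> Q * int C"
        using c that kQ kpos by (intro mult_mono) auto
      finally show ?thesis .
    qed
    moreover have "d x = 0" by (simp add: d_def)
    moreover have "t' \<in> signed_sums E (fact C * K)"
    proof -
      have "nat \<bar>- sgn (c x) * int k\<bar> = k" using False by (simp add: abs_mult abs_sgn_eq)
      moreover have "k \<le> fact C" using kQ \<open>Q = int (fact C)\<close> by linarith
      ultimately show ?thesis unfolding t'_def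
        by (intro signed_sums_scale[OF t]) (simp add: mult_le_mono1)
    qed
    ultimately have "sgn (Q * v - ((\<Sum>i<N. d i * e i) + t')) = sgn (Q * v' - ((\<Sum>i<N. d i * e' i) + t'))"
      by (rule cut)
    thus ?thesis by (simp only: sum_fun_upd_split[OF x] key)
  qed
qed

text \<open>This is the back-and-forth step. Call the values \<open>g d t e\<close> cut points and
  put \<open>W = C! * M\<close>. If \<open>C! * v\<close> lies at distance at most \<open>W\<close>
  above a cut point, the same offset is copied to the other side. Otherwise it lies more than
  \<open>W\<close> above the largest cut point below it; the corresponding gap for \<open>e'\<close>
  is also longer than \<open>W\<close>, and so contains \<open>C! * v'\<close> for some
  \<open>v'\<close> congruent to \<open>v\<close> modulo \<open>M\<close>.\<close>

lemma indist_extend: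
  fixes C K M :: nat
  assumes E1: "1 \<in> E" and Eunb: "\<And>b. \<exists>y\<in>E. b \<le> y"
    and x: "x < N" and M: "M > 0" and K: "K > 0"
    and hyp: "indist N E (2 * fact C * C) (2 * fact C * K + fact C * M) (fact C * M) e e'"
  shows "\<exists>v'. indist N E C K M (e(x := v)) (e'(x := v'))"
proof -
  define Q :: int where "Q = fact C"
  have Qint: "Q = int (fact C)" by (simp add: Q_def)
  have Q1: "Q \<ge> 1" unfolding Q_def by simp
  define W where "W = Q * int M"
  have WM: "W = int (fact C * M)" by (simp add: W_def Qint)
  define ok where "ok = (\<lambda>d t. (\<forall>i<N. \<bar>d i\<bar> \<le> Q * int C) \<and> d x = 0 \<and> t \<in> signed_sums E (fact C * K))"
  define g where "g = (\<lambda>d t f. (\<Sum>i<N. d i * f i) + t :: int)"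
  have hyp': "indist N E C K M e e'"
  proof (rule indist_mono[OF hyp])
    have "1 * C \<le> 2 * fact C * C" "1 * K \<le> 2 * fact C * K"
      by (intro mult_le_mono1, simp add: Suc_le_eq)+
    thus "C \<le> 2 * fact C * C" "K \<le> 2 * fact C * K + fact C * M"
      by (simp, metis mult_1 trans_le_add1)
  qed simp
  \<comment> \<open>Order and distances up to \<open>W\<close> between cut points transfer. In a
    difference of two of them the coefficient bound doubles, the parameters use
    \<open>2 * C! * K\<close> summands, and the shift uses at most \<open>C! * M\<close> summands
    \<open>\<plusminus>1\<close>; this dictates the constants of the lemma.\<close>
  have sgn_diff: "sgn (g d1 t1 e - g d2 t2 e + \<delta>) = sgn (g d1 t1 e' - g d2 t2 e' + \<delta>)"
    if "ok d1 t1" "ok d2 t2" "\<bar>\<delta>\<bar> \<le> W" for d1 t1 d2 t2 \<delta>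
  proof -
    have "t1 - t2 + \<delta> \<in> signed_sums E (fact C * K + fact C * K + fact C * M)"
    proof (rule signed_sums_add[OF signed_sums_diff])
      show "\<delta> \<in> signed_sums E (fact C * M)"
        using that(3) by (intro const_in_signed_sums[OF E1]) (simp add: WM nat_le_iff)
    qed (use that in \<open>auto simp: ok_def\<close>)
    hence "t1 - t2 + \<delta> \<in> signed_sums E (2 * fact C * K + fact C * M)" by (simp only: mult_2 distrib_right)
    moreover have "\<bar>d1 i - d2 i\<bar> \<le> int (2 * fact C * C)" if "i < N" for i
    proof -
      have "\<bar>d1 i\<bar> \<le> Q * int C" "\<bar>d2 i\<bar> \<le> Q * int C"
        using \<open>ok d1 t1\<close> \<open>ok d2 t2\<close> that unfolding ok_def by auto
      thus ?thesis unfolding Qint by (simp add: algebra_simps)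
    qed
    ultimately have "sgn ((\<Sum>i<N. (d1 i - d2 i) * e i) + (t1 - t2 + \<delta>)) =
        sgn ((\<Sum>i<N. (d1 i - d2 i) * e' i) + (t1 - t2 + \<delta>))"
      by (intro indist_sgn[OF hyp])
    thus ?thesis unfolding g_def by (simp add: algebra_simps sum_subtractf)
  qed
  have cut: "\<exists>v'. [v = v'] (mod int M) \<and>
      (\<forall>d t. ok d t \<longrightarrow> sgn (Q * v - g d t e) = sgn (Q * v' - g d t e'))"
  proof (cases "\<exists>d t \<delta>. ok d t \<and> 0 \<le> \<delta> \<and> \<delta> \<le> W \<and> Q * v = g d t e + \<delta>")
    case True
    then obtain d t \<delta> where dt: "ok d t" "0 \<le> \<delta>" "\<delta> \<le> W" "Q * v = g d t e + \<delta>" by blast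
    \<comment> \<open>The congruence modulo \<open>W = Q * M\<close>, rather than \<open>M\<close>,
      makes the copied value divisible by \<open>Q\<close> with a quotient congruent to
      \<open>v\<close> modulo \<open>M\<close>.\<close>
    have "[e i = e' i] (mod W)" if "i < N" for i
      using indist_cong[OF hyp that] by (simp only: WM)
    hence "[g d t e + \<delta> = g d t e' + \<delta>] (mod W)"
      unfolding g_def by (intro cong_add cong_sum cong_mult cong_refl) simp
    hence cong: "[Q * v = g d t e' + \<delta>] (mod W)" using dt by simp
    hence "Q dvd Q * v - (g d t e' + \<delta>)"
      by (auto simp: cong_iff_dvd_diff W_def intro: dvd_mult_left)
    hence "Q dvd Q * v - (Q * v - (g d t e' + \<delta>))" by (rule dvd_diff[OF dvd_triv_left])
    hence "Q dvd g d t e' + \<delta>" by (simp only: diff_diff_eq2 add_diff_cancel_left')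
    then obtain v' where v': "g d t e' + \<delta> = Q * v'" by (elim dvdE)
    have "[v = v'] (mod int M)"
      using cong Q1 unfolding v' W_def cong_iff_dvd_diff right_diff_distrib[symmetric] by simp
    moreover have "sgn (Q * v - g d2 t2 e) = sgn (Q * v' - g d2 t2 e')" if "ok d2 t2" for d2 t2
      using sgn_diff[OF dt(1) that, of \<delta>] dt v' by (simp add: algebra_simps)
    ultimately show ?thesis by blast
  next
    case False
    define A where "A = {g d t e | d t. ok d t \<and> g d t e \<le> Q * v}"
    \<comment> \<open>The cut point \<open>- y\<close> is at most \<open>Q * v\<close>, so
      \<open>A\<close> is nonempty; \<open>K > 0\<close> makes \<open>- y\<close> available as a
      parameter.\<close>
    obtain y where y: "y \<in> E" "- (Q * v) \<le> y" using Eunb by blast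
    have "- y \<in> signed_sums E (fact C * K)"
      using K by (intro signed_sums_mono[OF _ signed_sums_uminus[OF base_in_signed_sums[OF y(1)]]])
        (simp add: Suc_le_eq)
    hence "ok (\<lambda>_. 0) (- y)" using Q1 by (auto simp: ok_def)
    moreover have "g (\<lambda>_. 0) (- y) e = - y" by (simp add: g_def)
    ultimately have "- y \<in> A" using y(2) unfolding A_def by force
    moreover have "a \<le> Q * v" if "a \<in> A" for a using that by (auto simp: A_def)
    ultimately obtain m where m: "m \<in> A" "\<And>a. a \<in> A \<Longrightarrow> a \<le> m"
      using int_set_has_max[of "-y" A "Q * v"] by blast
    obtain d t where dt: "ok d t" "m = g d t e" "g d t e \<le> Q * v" using m(1) by (auto simp: A_def)
    define h where "h = g d t e'"
    have gap: "Q * v > m + W"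
    proof (rule ccontr)
      assume "\<not> Q * v > m + W"
      hence "ok d t \<and> 0 \<le> Q * v - m \<and> Q * v - m \<le> W \<and> Q * v = g d t e + (Q * v - m)" using dt by auto
      thus False using False by blast
    qed
    have W1: "W > 0" using Q1 M by (simp add: W_def)
    \<comment> \<open>This choice makes \<open>Q * v'\<close> the representative of
      \<open>Q * v\<close> modulo \<open>W\<close> between \<open>h + 1\<close> and
      \<open>h + W\<close>; the \<open>- 1\<close> keeps it off the cut point \<open>h\<close>
      itself.\<close>
    define v' where "v' = v - int M * ((Q * v - h - 1) div W)"
    have "Q * v' - h - 1 = (Q * v - h - 1) mod W"
      unfolding v'_def by (simp add: minus_mult_div_eq_mod[symmetric] W_def algebra_simps)
    hence hv: "h < Q * v'" "Q * v' \<le> h + W" using pos_mod_bound[OF W1, of "Q * v - h - 1"]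
        pos_mod_sign[OF W1, of "Q * v - h - 1"] by linarith+
    have "[v = v'] (mod int M)" unfolding v'_def by (simp add: cong_iff_dvd_diff)
    moreover have "sgn (Q * v - g d2 t2 e) = sgn (Q * v' - g d2 t2 e')" if ok2: "ok d2 t2" for d2 t2
    proof (cases "g d2 t2 e \<le> Q * v")
      case True
      hence "g d2 t2 e \<le> m" using m(2) ok2 by (auto simp: A_def)
      hence "g d2 t2 e' \<le> h"
        using sgn_eq_int_iffs(3)[OF sgn_diff[OF ok2 dt(1), of 0]] W1 dt(2) by (simp add: h_def)
      moreover have "g d2 t2 e \<noteq> Q * v"
      proof
        assume "g d2 t2 e = Q * v"
        hence "ok d2 t2 \<and> 0 \<le> (0::int) \<and> 0 \<le> W \<and> Q * v = g d2 t2 e + 0" using ok2 W1 by simp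
        thus False using \<open>\<nexists>d t \<delta>. ok d t \<and> 0 \<le> \<delta> \<and> \<delta> \<le> W \<and> Q * v = g d t e + \<delta>\<close> by blast
      qed
      ultimately show ?thesis using True hv by simp
    next
      case False
      hence "m + W - g d2 t2 e < 0" using gap by simp
      hence "h + W - g d2 t2 e' < 0"
        using sgn_eq_int_iffs(2)[OF sgn_diff[OF dt(1) ok2, of W]] W1 dt(2) by (simp add: h_def algebra_simps)
      thus ?thesis using False hv by simp
    qed
    ultimately show ?thesis by blast
  qed
  then obtain v' where v': "[v = v'] (mod int M)"
    "\<And>d t. ok d t \<Longrightarrow> sgn (Q * v - g d t e) = sgn (Q * v' - g d t e')" by blast
  have "indist N E C K M (e(x := v)) (e'(x := v'))"
    by (rule indist_fun_updI[OF x hyp' v'(1) Q_def]) (use v'(2) in \<open>auto simp: ok_def g_def\<close>)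
  thus ?thesis by blast
qed

section \<open>Invariance of formulas under indistinguishability\<close>

lemma indist_sym: "indist N E C K M e e' \<Longrightarrow> indist N E C K M e' e"
  by (auto simp: indist_def cong_sym_eq)

text \<open>Bound variables are included: evaluating a quantifier updates the valuation at the bound
  variable, whose index must be below \<open>N\<close> as well.\<close>

primrec all_vars :: "fm \<Rightarrow> nat set" where
  "all_vars (Equal s t) = vars_trm s \<union> vars_trm t"
| "all_vars (Less s t) = vars_trm s \<union> vars_trm t"
| "all_vars (Pred i t) = vars_trm t"
| "all_vars (Neg \<phi>) = all_vars \<phi>"
| "all_vars (Conj \<phi> \<psi>) = all_vars \<phi> \<union> all_vars \<psi>"
| "all_vars (Exists x \<phi>) = insert x (all_vars \<phi>)"

lemma finite_vars_trm: "finite (vars_trm t)"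
  by (induction t) auto

lemma finite_all_vars: "finite (all_vars \<phi>)"
  by (induction \<phi>) (auto simp: finite_vars_trm)

lemma eval_trm_linear:
  assumes "vars_trm t \<subseteq> {..<N}"
  shows "\<exists>c C. (\<forall>i<N. \<bar>c i\<bar> \<le> int C) \<and> (\<forall>e. eval_trm e t = (\<Sum>i<N. c i * e i))"
  using assms
proof (induction t)
  case (Var x)
  have "(\<Sum>i<N. (if i = x then 1 else 0) * e i) = e x" for e :: "nat \<Rightarrow> int"
    using Var by (simp add: if_distrib[of "\<lambda>a. a * _"] cong: if_cong)
  thus ?case by (intro exI[of _ "\<lambda>i. if i = x then 1 else 0"] exI[of _ 1]) auto
next
  case (Add s t)
  then obtain c C c' C' where *: "\<forall>i<N. \<bar>c i\<bar> \<le> int C" "\<forall>e. eval_trm e s = (\<Sum>i<N. c i * e i)"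
    "\<forall>i<N. \<bar>c' i\<bar> \<le> int C'" "\<forall>e. eval_trm e t = (\<Sum>i<N. c' i * e i)" by auto
  show ?case
    by (intro exI[of _ "\<lambda>i. c i + c' i"] exI[of _ "C + C'"])
       (use * in \<open>force simp: algebra_simps sum.distrib\<close>)
qed

text \<open>Atomic formulas reduce to sign conditions on linear forms, and
  \<open>indist_extend\<close> carries a witness of an existential quantifier from one valuation to
  the other. Positivity of \<open>K\<close> and \<open>M\<close> is maintained for the sake of that
  extension.\<close>

lemma sat_indist:
  assumes E1: "1 \<in> E" and Eunb: "\<And>b. \<exists>y\<in>E. b \<le> y" and PE: "\<And>P. P \<in> set Ps \<Longrightarrow> P \<subseteq> E"
  assumes "all_vars \<phi> \<subseteq> {..<N}" "in_language (length Ps) \<phi>"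
  shows "\<exists>C K M. K > 0 \<and> M > 0 \<and> (\<forall>e e'. indist N E C K M e e' \<longrightarrow> sat Ps e \<phi> = sat Ps e' \<phi>)"
  using assms(4,5)
proof (induction \<phi>)
  case (Equal s t)
  then obtain c C c' C' where *: "\<forall>i<N. \<bar>c i\<bar> \<le> int C" "\<forall>e. eval_trm e s = (\<Sum>i<N. c i * e i)"
    "\<forall>i<N. \<bar>c' i\<bar> \<le> int C'" "\<forall>e. eval_trm e t = (\<Sum>i<N. c' i * e i)"
    using eval_trm_linear[of s N] eval_trm_linear[of t N] by auto
  have "sat Ps e (Equal s t) = sat Ps e' (Equal s t)" if "indist N E (C + C') 1 1 e e'" for e e'
  proof -
    have "sgn ((\<Sum>i<N. (c i - c' i) * e i) + 0) = sgn ((\<Sum>i<N. (c i - c' i) * e' i) + 0)"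
      using * by (intro indist_sgn[OF that] zero_in_signed_sums) force
    moreover have "(\<Sum>i<N. (c i - c' i) * f i) + 0 = eval_trm f s - eval_trm f t" for f
      using * by (simp add: algebra_simps sum_subtractf)
    ultimately have "sgn (eval_trm e s - eval_trm e t) = sgn (eval_trm e' s - eval_trm e' t)" by simp
    from sgn_eq_int_iffs(1)[OF this] show ?thesis by simp
  qed
  thus ?case by (intro exI[of _ "C + C'"] exI[of _ 1]) auto
next
  case (Less s t)
  then obtain c C c' C' where *: "\<forall>i<N. \<bar>c i\<bar> \<le> int C" "\<forall>e. eval_trm e s = (\<Sum>i<N. c i * e i)"
    "\<forall>i<N. \<bar>c' i\<bar> \<le> int C'" "\<forall>e. eval_trm e t = (\<Sum>i<N. c' i * e i)"
    using eval_trm_linear[of s N] eval_trm_linear[of t N] by auto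
  have "sat Ps e (Less s t) = sat Ps e' (Less s t)" if "indist N E (C + C') 1 1 e e'" for e e'
  proof -
    have "sgn ((\<Sum>i<N. (c i - c' i) * e i) + 0) = sgn ((\<Sum>i<N. (c i - c' i) * e' i) + 0)"
      using * by (intro indist_sgn[OF that] zero_in_signed_sums) force
    moreover have "(\<Sum>i<N. (c i - c' i) * f i) + 0 = eval_trm f s - eval_trm f t" for f
      using * by (simp add: algebra_simps sum_subtractf)
    ultimately have "sgn (eval_trm e s - eval_trm e t) = sgn (eval_trm e' s - eval_trm e' t)" by simp
    from sgn_eq_int_iffs(2)[OF this] show ?thesis by simp
  qed
  thus ?case by (intro exI[of _ "C + C'"] exI[of _ 1]) auto
next
  case (Pred j t)
  then obtain c C where *: "\<forall>i<N. \<bar>c i\<bar> \<le> int C" "\<forall>e. eval_trm e t = (\<Sum>i<N. c i * e i)"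
    using eval_trm_linear[of t N] by auto
  have "sat Ps e' (Pred j t)" if "indist N E C 1 1 e e'" "sat Ps e (Pred j t)" for e e'
  proof -
    \<comment> \<open>The value \<open>?p\<close> lies in \<open>E\<close> and therefore serves as a
      parameter: the form minus \<open>?p\<close> has sign 0 at \<open>e\<close>, hence also at
      \<open>e'\<close>, so the term takes the very same value there.\<close>
    let ?p = "eval_trm e t"
    have "?p \<in> Ps ! j" using that by simp
    moreover have "Ps ! j \<subseteq> E" using Pred PE by simp
    ultimately have "- ?p \<in> signed_sums E 1" using signed_sums_uminus[OF base_in_signed_sums] by auto
    hence "sgn ((\<Sum>i<N. c i * e i) + - ?p) = sgn ((\<Sum>i<N. c i * e' i) + - ?p)"
      using * by (intro indist_sgn[OF that(1)]) auto
    from sgn_eq_int_iffs(1)[OF this] have "eval_trm e' t = ?p" using * by simp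
    thus ?thesis using \<open>?p \<in> Ps ! j\<close> by simp
  qed
  thus ?case using indist_sym by (intro exI[of _ C] exI[of _ 1]) blast
next
  case (Neg \<phi>)
  thus ?case by simp
next
  case (Conj \<phi> \<psi>)
  then obtain C K M C' K' M' where
    *: "K > 0" "M > 0" "\<And>e e'. indist N E C K M e e' \<Longrightarrow> sat Ps e \<phi> = sat Ps e' \<phi>"
       "K' > 0" "M' > 0" "\<And>e e'. indist N E C' K' M' e e' \<Longrightarrow> sat Ps e \<psi> = sat Ps e' \<psi>"
    by (auto; metis)
  have "sat Ps e (Conj \<phi> \<psi>) = sat Ps e' (Conj \<phi> \<psi>)"
    if "indist N E (max C C') (max K K') (M * M') e e'" for e e'
    using *(3)[OF indist_mono[OF that]] *(6)[OF indist_mono[OF that]] by simp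
  thus ?case using * by (intro exI[of _ "max C C'"] exI[of _ "max K K'"] exI[of _ "M * M'"]) auto
next
  case (Exists x \<phi>)
  then obtain C K M where
    *: "K > 0" "M > 0" "\<And>e e'. indist N E C K M e e' \<Longrightarrow> sat Ps e \<phi> = sat Ps e' \<phi>"
    by auto
  have x: "x < N" using Exists.prems by simp
  let ?C = "2 * fact C * C" and ?K = "2 * fact C * K + fact C * M" and ?M = "fact C * M"
  have "sat Ps e' (Exists x \<phi>)" if "indist N E ?C ?K ?M e e'" "sat Ps e (Exists x \<phi>)" for e e'
    using indist_extend[OF E1 Eunb x *(2,1) that(1)] that(2) *(3) by (metis sat.simps(6))
  thus ?case using indist_sym * by (intro exI[of _ ?C] exI[of _ ?K] exI[of _ ?M]) (auto; blast)
qed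

text \<open>A definable relation cannot separate two points of a long gap in the set of
  signed sums, whereas divisibility does.\<close>

lemma mult_not_definable:
  assumes E1: "1 \<in> E" and Eunb: "\<And>b. \<exists>y\<in>E. b \<le> y" and PE: "\<And>P. P \<in> set Ps \<Longrightarrow> P \<subseteq> E"
    and sparse: "\<And>K. signed_sums E K \<noteq> UNIV"
  shows "\<not> definable_binary_fun Ps (\<lambda>x y. x * y)"
proof
  assume "definable_binary_fun Ps (\<lambda>x y. x * y)"
  then obtain \<phi> where lang: "in_language (length Ps) \<phi>" and
    \<phi>: "{[x, y, x * y] | x y. True} = {xs. length xs = 3 \<and> sat Ps (\<lambda>i. if i < 3 then xs ! i else 0) \<phi>}"
    unfolding definable_binary_fun_def definable_def by auto
  \<comment> \<open>Variable 1 is the second factor; quantifying over it leaves divisibility of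
    variable 2 by variable 0.\<close>
  define \<psi> where "\<psi> = Exists 1 \<phi>"
  define as :: "int \<Rightarrow> int \<Rightarrow> nat \<Rightarrow> int"
    where "as = (\<lambda>p x i. if i = 0 then p else if i = 2 then x else 0)"
  have \<psi>: "sat Ps (as p x) \<psi> \<longleftrightarrow> p dvd x" for p x
  proof -
    have "(as p x)(1 := y) = (\<lambda>i. if i < 3 then [p, y, x] ! i else 0)" for y
      by (auto simp: as_def fun_eq_iff numeral_3_eq_3 less_Suc_eq)
    hence "sat Ps (as p x) \<psi> \<longleftrightarrow> (\<exists>y. [p, y, x] \<in> {[x, y, x * y] | x y. True})"
      unfolding \<phi> \<psi>_def by simp
    thus ?thesis by (auto simp: dvd_def)
  qed
  obtain N0 where "all_vars \<psi> \<subseteq> {..<N0}"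
    using finite_all_vars[of \<psi>] finite_nat_iff_bounded by blast
  define N where "N = N0 + 3"
  have N: "all_vars \<psi> \<subseteq> {..<N}" using \<open>all_vars \<psi> \<subseteq> {..<N0}\<close> by (auto simp: N_def)
  have "in_language (length Ps) \<psi>" using lang by (simp add: \<psi>_def)
  then obtain C K M where M: "M > 0"
    and ind: "\<And>e e'. indist N E C K M e e' \<Longrightarrow> sat Ps e \<psi> = sat Ps e' \<psi>"
    using sat_indist[OF E1 Eunb PE N] by blast
  \<comment> \<open>Being larger than \<open>M\<close>, this \<open>p\<close> cannot divide both
    \<open>x\<close> and \<open>x + int M\<close>, although the two agree modulo
    \<open>M\<close>.\<close>
  define p where "p = int M + 1"
  have p: "p > 1" using M by (simp add: p_def)
  define Q :: int where "Q = fact C"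
  have Q1: "Q \<ge> 1" unfolding Q_def by simp
  have Qint: "Q = int (fact C)" by (simp add: Q_def)
  \<comment> \<open>The contribution \<open>c 0 * p\<close> of variable 0 counts as at most
    \<open>C * p\<close> summands \<open>\<plusminus>1\<close>. The factor \<open>fact C\<close> in
    \<open>K2\<close> pays for clearing the coefficient \<open>c 2\<close>.\<close>
  define K1 where "K1 = K + C * nat p"
  define K2 where "K2 = fact C * K1"
  \<comment> \<open>If every such interval met the signed sums, each integer would be at bounded
    distance from one of them and hence, as 1 is in \<open>E\<close>, itself a sum of boundedly many
    terms.\<close>
  have "\<exists>x. p dvd x \<and> signed_sums E K2 \<inter> {Q * x..Q * x + Q * int M} = {}"
  proof (rule ccontr)
    assume "\<nexists>x. p dvd x \<and> signed_sums E K2 \<inter> {Q * x..Q * x + Q * int M} = {}"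
    hence near: "\<exists>s. s \<in> signed_sums E K2 \<and> Q * x \<le> s \<and> s \<le> Q * x + Q * int M" if "p dvd x" for x
      using that by fastforce
    have "n \<in> signed_sums E (K2 + nat (Q * p + Q * int M))" for n
    proof -
      define k where "k = n div (Q * p)"
      have Qp: "Q * p > 0" using Q1 p by simp
      obtain s where s: "s \<in> signed_sums E K2" "Q * (p * k) \<le> s" "s \<le> Q * (p * k) + Q * int M"
        using near[of "p * k"] by auto
      have "n = Q * p * k + n mod (Q * p)" by (simp add: k_def)
      hence "\<bar>n - s\<bar> \<le> Q * p + Q * int M"
        using s pos_mod_bound[OF Qp, of n] pos_mod_sign[OF Qp, of n] Qp Q1 M
        by (simp only: mult.assoc abs_le_iff) linarith
      hence "n - s \<in> signed_sums E (nat (Q * p + Q * int M))"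
        by (intro const_in_signed_sums[OF E1]) simp
      from signed_sums_add[OF s(1) this] show ?thesis by simp
    qed
    thus False using sparse by blast
  qed
  then obtain x where x: "p dvd x" "signed_sums E K2 \<inter> {Q * x..Q * x + Q * int M} = {}" by blast
  have "indist N E C K M (as p x) (as p (x + int M))"
    unfolding indist_def
  proof (intro conjI allI impI)
    fix i assume "i < N"
    show "[as p x i = as p (x + int M) i] (mod int M)" by (auto simp: as_def cong_iff_dvd_diff)
  next
    fix c t assume c: "\<forall>i<N. \<bar>c i\<bar> \<le> int C" and t: "t \<in> signed_sums E K"
    have sum: "(\<Sum>i<N. c i * as p y i) = c 0 * p + c 2 * y" for y
    proof -
      have "(\<Sum>i<N. c i * as p y i) = (\<Sum>i\<in>{0,2}. c i * as p y i)"
        by (rule sum.mono_neutral_right) (auto simp: as_def N_def)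
      thus ?thesis by (simp add: as_def)
    qed
    define u where "u = - (c 0 * p + t)"
    have "c 0 * p + t \<in> signed_sums E (C * nat p + K)"
    proof (intro signed_sums_add t const_in_signed_sums[OF E1])
      have "\<bar>c 0\<bar> * p \<le> int C * p" using c p by (intro mult_right_mono) (auto simp: N_def)
      thus "nat \<bar>c 0 * p\<bar> \<le> C * nat p" using p by (simp add: abs_mult nat_le_iff)
    qed
    hence u: "u \<in> signed_sums E K1" unfolding u_def K1_def by (metis signed_sums_uminus add.commute)
    show "sgn ((\<Sum>i<N. c i * as p x i) + t) = sgn ((\<Sum>i<N. c i * as p (x + int M) i) + t)"
    proof (cases "c 2 = 0")
      case False
      have "nat \<bar>c 2\<bar> dvd fact C" using c False by (intro dvd_fact) (auto simp: N_def nat_le_iff)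
      then obtain k where k: "fact C = nat \<bar>c 2\<bar> * k" by (elim dvdE)
      hence Qk: "Q = \<bar>c 2\<bar> * int k" using Qint by simp
      have kpos: "k > 0" using k by (metis fact_nonzero gr0I mult_0_right)
      \<comment> \<open>After scaling by \<open>k = Q / \<bar>c 2\<bar>\<close>, the signs at
        \<open>x\<close> and \<open>x + int M\<close> could differ only if \<open>s\<close> were in
        the gap found above.\<close>
      define s where "s = sgn (c 2) * int k * u"
      have kf: "k \<le> fact C" unfolding k using False by (simp add: Suc_le_eq)
      have "s \<in> signed_sums E K2"
        unfolding s_def K2_def using kf False
        by (intro signed_sums_scale[OF u]) (simp add: abs_mult abs_sgn_eq mult_le_mono1)
      hence "s < Q * x \<or> s > Q * x + Q * int M" using x(2) by force
      moreover have eq: "sgn (c 2 * y - u) = sgn (c 2) * sgn (Q * y - s)" for y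
      proof -
        have "\<bar>c 2\<bar> = sgn (c 2) * c 2" by (simp add: abs_sgn mult.commute)
        hence "Q * y - s = sgn (c 2) * int k * (c 2 * y - u)"
          unfolding Qk s_def by (simp add: algebra_simps)
        hence "sgn (c 2) * sgn (Q * y - s) = (sgn (c 2) * sgn (c 2)) * sgn (int k) * sgn (c 2 * y - u)"
          by (simp add: sgn_mult del: sgn_of_nat)
        also have "sgn (c 2) * sgn (c 2) = 1" using False by (simp add: sgn_if)
        finally show ?thesis using kpos by simp
      qed
      moreover have "Q * int M \<ge> 0" using Q1 by simp
      ultimately have "sgn (Q * x - s) = sgn (Q * (x + int M) - s)"
        by (auto simp: distrib_left)
      hence "sgn (c 2 * x - u) = sgn (c 2 * (x + int M) - u)" by (simp only: eq)
      thus ?thesis unfolding sum u_def by (simp add: algebra_simps)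
    qed (simp add: sum)
  qed
  hence "p dvd x + int M" using ind \<psi> x(1) by blast
  hence "p dvd int M" using x(1) by (simp add: dvd_add_right_iff)
  thus False using M zdvd_imp_le[of p "int M"] by (simp add: p_def)
qed

section \<open>Chebyshev and Mertens estimates\<close>

text \<open>Pairs \<open>(n, d)\<close> with \<open>d dvd n\<close> correspond to pairs
  \<open>(d, m)\<close> through \<open>n = d * m\<close>. This serves both the factorial formula and
  the convolutions with a character.\<close>

lemma sum_divisors_swap:
  fixes f :: "nat \<Rightarrow> nat \<Rightarrow> 'a :: comm_monoid_add"
  shows "(\<Sum>n=1..X. \<Sum>d | d dvd n. f d (n div d)) = (\<Sum>d=1..X. \<Sum>m=1..X div d. f d m)"
proof -
  have aux: "b \<le> X" if "b * k \<le> X" "0 < k" for b k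
    using le_trans[OF _ that(1), of b] that(2) by simp
  have "(\<Sum>n=1..X. \<Sum>d | d dvd n. f d (n div d)) =
        (\<Sum>(n, d)\<in>(SIGMA n:{1..X}. {d. d dvd n}). f d (n div d))"
    by (rule sum.Sigma) auto
  also have "\<dots> = (\<Sum>(d, m)\<in>(SIGMA d:{1..X}. {1..X div d}). f d m)"
    by (rule sum.reindex_bij_witness[of _ "\<lambda>(d, m). (d * m, d)" "\<lambda>(n, d). (d, n div d)"])
       (auto simp: Suc_le_eq div_le_mono less_eq_div_iff_mult_less_eq mult.commute
          dest: aux elim!: dvdE)
  also have "\<dots> = (\<Sum>d=1..X. \<Sum>m=1..X div d. f d m)"
    by (rule sum.Sigma[symmetric]) auto
  finally show ?thesis .
qed

lemma ln_fact_eq_sum: "ln (fact X :: real) = (\<Sum>n=1..X. ln (real n))"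
  by (induction X) (simp_all add: ln_mult add_ac)

text \<open>Legendre's formula in logarithmic form.\<close>

lemma ln_fact_mangoldt: "ln (fact X :: real) = (\<Sum>d=1..X. mangoldt d * real (X div d))"
proof -
  have "(\<Sum>n=1..X. ln (real n)) = (\<Sum>n=1..X. \<Sum>d | d dvd n. mangoldt d)"
    by (intro sum.cong) (auto simp: mangoldt_sum)
  also have "\<dots> = (\<Sum>d=1..X. \<Sum>m=1..X div d. mangoldt d)"
    by (rule sum_divisors_swap)
  finally show ?thesis by (simp add: ln_fact_eq_sum mult.commute)
qed

lemma ln_Suc_diff_le: "n > 0 \<Longrightarrow> real n * (ln (real (Suc n)) - ln (real n)) \<le> 1"
proof -
  assume n: "n > 0"
  have "ln (real (Suc n)) - ln (real n) = ln (real (Suc n) / real n)"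
    using n by (subst ln_div) auto
  also have "real (Suc n) / real n = 1 + 1 / real n" using n by (simp add: field_simps)
  also have "ln (1 + 1 / real n) \<le> 1 / real n" by (rule ln_add_one_self_le_self) auto
  finally show ?thesis using n by (simp add: field_simps)
qed

lemma ln_fact_ge: "ln (fact X :: real) \<ge> real X * ln (real X) - real X"
proof (induction X)
  case (Suc X)
  show ?case
  proof (cases "X = 0")
    case False
    have "ln (fact (Suc X) :: real) = ln (fact X) + ln (real (Suc X))" by (simp add: ln_mult)
    thus ?thesis using Suc ln_Suc_diff_le[of X] False by (simp add: algebra_simps)
  qed simp
qed simp

lemma ln_fact_le: "ln (fact X :: real) \<le> real X * ln (real X)"
proof -
  have "(\<Sum>n=1..X. ln (real n)) \<le> (\<Sum>n=1..X. ln (real X))" by (intro sum_mono) auto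
  thus ?thesis by (simp add: ln_fact_eq_sum)
qed

text \<open>Chebyshev's argument: the logarithm of the central binomial coefficient is at most
  \<open>n * ln 4\<close>, while Legendre's formula gives \<open>mangoldt d\<close> the coefficient
  \<open>2 * n div d - 2 * (n div d)\<close> in it, which is nonnegative and equals 1 for
  \<open>n < d \<le> 2 * n\<close>.\<close>

lemma psi_double_le: "(\<Sum>d=1..2*n. mangoldt d) \<le> (\<Sum>d=1..n. mangoldt d) + real n * ln 4"
proof -
  have split: "(\<Sum>d=1..2*n. g d) = (\<Sum>d=1..n. g d) + (\<Sum>d=Suc n..2*n. g d)" for g :: "nat \<Rightarrow> real"
    by (subst sum.union_disjoint[symmetric]) (auto intro!: sum.cong)
  have "fact (2 * n) = (fact n * fact n * real ((2*n) choose n))"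
    using binomial_fact_lemma[of n "2 * n"] by (metis diff_add_inverse2 le_add2 mult_2 of_nat_fact of_nat_mult)
  also have "ln \<dots> = ln (fact n) + ln (fact n) + ln (real ((2*n) choose n))"
    by (simp add: ln_mult)
  also have "ln (real ((2*n) choose n)) \<le> ln (real (2 ^ (2 * n)))"
    using binomial_le_pow2[of "2*n" n] by (subst ln_le_cancel_iff) (auto simp del: of_nat_power)
  also have "ln (real (2 ^ (2 * n))) = real n * ln 4"
    by (simp add: ln_realpow power_mult)
  finally have up: "ln (fact (2 * n) :: real) \<le> 2 * ln (fact n) + real n * ln 4" by simp
  have "2 * ln (fact n :: real) + (\<Sum>d=Suc n..2*n. mangoldt d) \<le>
        (\<Sum>d=1..n. mangoldt d * real (2 * n div d)) + (\<Sum>d=Suc n..2*n. mangoldt d * real (2 * n div d))"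
  proof (rule add_mono)
    have "2 * ln (fact n :: real) = (\<Sum>d=1..n. mangoldt d * real (2 * (n div d)))"
      by (simp add: ln_fact_mangoldt sum_distrib_left algebra_simps)
    also have "\<dots> \<le> (\<Sum>d=1..n. mangoldt d * real (2 * n div d))"
    proof (intro sum_mono mult_left_mono mangoldt_nonneg)
      fix d assume "d \<in> {1..n}"
      hence "2 * (n div d) \<le> 2 * n div d"
        by (simp add: less_eq_div_iff_mult_less_eq)
      thus "real (2 * (n div d)) \<le> real (2 * n div d)" by linarith
    qed
    finally show "2 * ln (fact n :: real) \<le> (\<Sum>d=1..n. mangoldt d * real (2 * n div d))" .
    show "(\<Sum>d=Suc n..2*n. mangoldt d) \<le> (\<Sum>d=Suc n..2*n. mangoldt d * real (2 * n div d))"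
    proof (intro sum_mono)
      fix d assume "d \<in> {Suc n..2*n}"
      hence "1 \<le> 2 * n div d" by (simp add: less_eq_div_iff_mult_less_eq)
      hence "1 \<le> real (2 * n div d)" by linarith
      thus "mangoldt d \<le> mangoldt d * real (2 * n div d)"
        using mangoldt_nonneg[of d] by (simp add: mult_le_cancel_left1)
    qed
  qed
  also have "\<dots> = ln (fact (2 * n))" unfolding ln_fact_mangoldt by (rule split[symmetric])
  finally have "(\<Sum>d=Suc n..2*n. mangoldt d) \<le> real n * ln 4" using up by linarith
  thus ?thesis unfolding split by simp
qed

text \<open>Induction by halving. As \<open>ln 4 \<le> 2\<close>, passing from \<open>m\<close> to
  \<open>2 * m\<close> costs at most \<open>2 * m\<close>; for odd \<open>n = 2 * m + 1\<close> the
  last term is at most \<open>ln (2 * m + 1) \<le> 2 * m\<close>.\<close>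

lemma psi_le: "(\<Sum>d=1..n. mangoldt d) \<le> 4 * real n"
proof (induction n rule: less_induct)
  case (less n)
  have "ln (4::real) = 2 * ln 2" using ln_realpow[of 2 2] by simp
  hence ln4: "ln (4::real) \<le> 2" using ln_2_less_1 by linarith
  have le: "real m * ln 4 \<le> 2 * real m" for m
    using mult_left_mono[OF ln4, of "real m"] by simp
  show ?case
  proof (cases "n = 0")
    case False
    define m where "m = n div 2"
    have m: "m < n" using False by (simp add: m_def)
    show ?thesis
    proof (cases "even n")
      case True
      hence "n = 2 * m" by (simp add: m_def)
      thus ?thesis using less[OF m] psi_double_le[of m] le[of m] by simp
    next
      case odd: False
      hence n: "n = Suc (2 * m)" by (simp add: m_def)
      have "mangoldt n \<le> ln (real n)" using mangoldt_le[of n] False by simp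
      also have "\<dots> \<le> 2 * real m" using ln_add_one_self_le_self[of "2 * real m"] by (simp add: n add.commute)
      finally show ?thesis using less[OF m] psi_double_le[of m] le[of m] by (simp add: n)
    qed
  qed simp
qed

lemma div_bounds_real:
  assumes "d > 0"
  shows "real X / real d - 1 \<le> real (X div d)" "real (X div d) \<le> real X / real d"
    "real X < real d * (real (X div d) + 1)"
proof -
  have eq: "X = d * (X div d) + X mod d" by simp
  have "X mod d < d" using assms by simp
  hence "X < d * (X div d + 1)" using eq by (simp only: distrib_left mult_1_right)
  hence "real X < real (d * (X div d + 1))" by (rule of_nat_less_iff[THEN iffD2])
  thus 1: "real X < real d * (real (X div d) + 1)" by (simp add: algebra_simps)
  show "real X / real d - 1 \<le> real (X div d)" using 1 assms by (simp add: field_simps)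
  show "real (X div d) \<le> real X / real d" by (rule of_nat_div_le_of_nat)
qed

lemma mertens_lower: "X > 0 \<Longrightarrow> (\<Sum>n=1..X. mangoldt n / real n) \<ge> ln (real X) - 1"
proof -
  assume X: "X > 0"
  have "real X * ln (real X) - real X \<le> (\<Sum>d=1..X. mangoldt d * real (X div d))"
    using ln_fact_ge[of X] by (simp add: ln_fact_mangoldt)
  also have "\<dots> \<le> (\<Sum>d=1..X. mangoldt d * (real X / real d))"
    by (intro sum_mono mult_left_mono mangoldt_nonneg) (auto simp: div_bounds_real)
  also have "\<dots> = real X * (\<Sum>n=1..X. mangoldt n / real n)"
    by (simp add: sum_distrib_left mult_ac)
  finally have "real X * (ln (real X) - 1) \<le> real X * (\<Sum>n=1..X. mangoldt n / real n)"
    by (simp add: algebra_simps)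
  thus ?thesis using X by simp
qed

text \<open>Replacing \<open>X div d\<close> by \<open>X / d\<close> in Legendre's formula costs at
  most the Chebyshev sum, bounded by \<open>4 * X\<close>; hence the constant 4.\<close>

lemma mertens_upper: "X > 0 \<Longrightarrow> (\<Sum>n=1..X. mangoldt n / real n) \<le> ln (real X) + 4"
proof -
  assume X: "X > 0"
  have "real X * (\<Sum>n=1..X. mangoldt n / real n) - (\<Sum>n=1..X. mangoldt n) =
      (\<Sum>d=1..X. mangoldt d * (real X / real d - 1))"
    by (simp add: sum_distrib_left mult_ac algebra_simps sum_subtractf)
  also have "\<dots> \<le> (\<Sum>d=1..X. mangoldt d * real (X div d))"
    by (intro sum_mono mult_left_mono mangoldt_nonneg div_bounds_real) auto
  also have "\<dots> \<le> real X * ln (real X)"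
    using ln_fact_le[of X] by (simp add: ln_fact_mangoldt)
  finally have "real X * (\<Sum>n=1..X. mangoldt n / real n) \<le> real X * (ln (real X) + 4)"
    using psi_le[of X] by (simp add: algebra_simps)
  thus ?thesis using X by simp
qed

section \<open>The Moebius function and inversion\<close>

definition moebius :: "nat \<Rightarrow> int" where
  "moebius n = (if squarefree n then (-1) ^ card (prime_factors n) else 0)"

lemma abs_moebius_le: "\<bar>moebius n\<bar> \<le> 1"
  by (simp add: moebius_def)

lemma moebius_prime_mult:
  assumes "prime p" "\<not> p dvd n" "n > 0"
  shows "moebius (p * n) = - moebius n"
proof -
  have cop: "coprime p n" using assms by (simp add: prime_imp_coprime)
  have "squarefree (p * n) \<longleftrightarrow> squarefree n"
    using assms cop by (auto simp: squarefree_mult_coprime squarefree_prime dest: squarefree_multD)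
  moreover have "prime_factors (p * n) = insert p (prime_factors n)"
    using assms by (auto simp: prime_factors_product prime_prime_factors)
  moreover have "p \<notin> prime_factors n" using assms by auto
  ultimately show ?thesis by (simp add: moebius_def)
qed

text \<open>For a prime \<open>p\<close> dividing \<open>n\<close>, the divisors \<open>d\<close>
  not divisible by \<open>p\<close> cancel against those of the form \<open>p * d\<close>; the
  remaining divisors are multiples of \<open>p^2\<close> and contribute zero.\<close>

lemma sum_moebius: "n > 0 \<Longrightarrow> (\<Sum>d | d dvd n. moebius d) = (if n = 1 then 1 else 0)"
proof (cases "n = 1")
  case False
  assume n: "n > 0"
  obtain p where p: "prime p" "p dvd n" using False prime_factor_nat by blast
  have fin: "finite {d. d dvd n}" using n by simp
  have "(\<Sum>d | d dvd n. moebius d) = (\<Sum>d | d dvd n \<and> p dvd d. moebius d) + (\<Sum>d | d dvd n \<and> \<not> p dvd d. moebius d)"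
    by (subst sum.union_disjoint[symmetric]) (use fin in \<open>auto intro!: sum.cong\<close>)
  also have "(\<Sum>d | d dvd n \<and> p dvd d. moebius d) = (\<Sum>d\<in>(*) p ` {d. d dvd n \<and> \<not> p dvd d}. moebius d)"
  proof (rule sum.mono_neutral_right)
    show "(*) p ` {d. d dvd n \<and> \<not> p dvd d} \<subseteq> {d. d dvd n \<and> p dvd d}"
      using p by (auto intro!: divides_mult simp: prime_imp_coprime)
    show "\<forall>i\<in>{d. d dvd n \<and> p dvd d} - (*) p ` {d. d dvd n \<and> \<not> p dvd d}. moebius i = 0"
    proof
      fix i assume i: "i \<in> {d. d dvd n \<and> p dvd d} - (*) p ` {d. d dvd n \<and> \<not> p dvd d}"
      then obtain j where j: "i = p * j" by (auto elim: dvdE)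
      have "j dvd n" using i j by (auto intro: dvd_trans)
      hence "p dvd j" using i j by auto
      hence "p\<^sup>2 dvd i" using j by (simp add: power2_eq_square)
      hence "\<not> squarefree i" using p not_prime_unit by (auto simp: squarefree_def)
      thus "moebius i = 0" by (simp add: moebius_def)
    qed
  qed (use fin in auto)
  also have "\<dots> = (\<Sum>d | d dvd n \<and> \<not> p dvd d. moebius (p * d))"
    using p by (subst sum.reindex) (auto simp: inj_on_def prime_gt_0_nat)
  also have "\<dots> = (\<Sum>d | d dvd n \<and> \<not> p dvd d. - moebius d)"
    using p n by (intro sum.cong refl moebius_prime_mult) (auto intro: dvd_pos_nat)
  finally show ?thesis using False by (simp add: sum_negf)
qed (simp add: moebius_def)

text \<open>Moebius inversion of the identity that writes \<open>ln\<close> as a divisor sum of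
  \<open>mangoldt\<close>.\<close>

lemma mangoldt_conv_moebius:
  assumes "n > 0"
  shows "(\<Sum>d | d dvd n. real_of_int (moebius d) * ln (real (n div d))) = mangoldt n"
proof -
  have "(\<Sum>d | d dvd n. real_of_int (moebius d) * ln (real (n div d))) =
        (\<Sum>d | d dvd n. \<Sum>e | e dvd n div d. real_of_int (moebius d) * mangoldt e)"
  proof (intro sum.cong refl)
    fix d assume "d \<in> {d. d dvd n}"
    hence "n div d \<noteq> 0" using assms by (auto elim!: dvdE)
    hence "ln (real (n div d)) = (\<Sum>e | e dvd n div d. mangoldt e)"
      using mangoldt_sum[of "n div d", where 'a = real] by simp
    thus "real_of_int (moebius d) * ln (real (n div d)) = (\<Sum>e | e dvd n div d. real_of_int (moebius d) * mangoldt e)"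
      by (simp only: sum_distrib_left)
  qed
  also have "\<dots> = (\<Sum>(d, e)\<in>(SIGMA d:{d. d dvd n}. {e. e dvd n div d}). real_of_int (moebius d) * mangoldt e)"
    using assms by (intro sum.Sigma) (auto elim!: dvdE)
  also have "\<dots> = (\<Sum>(e, d)\<in>(SIGMA e:{e. e dvd n}. {d. d dvd n div e}). real_of_int (moebius d) * mangoldt e)"
    using assms by (intro sum.reindex_bij_witness[of _ "\<lambda>(e, d). (d, e)" "\<lambda>(e, d). (d, e)"])
      (auto elim!: dvdE simp: mult_ac)
  also have "\<dots> = (\<Sum>e | e dvd n. \<Sum>d | d dvd n div e. real_of_int (moebius d) * mangoldt e)"
    using assms by (intro sum.Sigma[symmetric]) (auto elim!: dvdE)
  also have "\<dots> = (\<Sum>e | e dvd n. if e = n then mangoldt e else 0)"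
  proof (intro sum.cong refl)
    fix e assume e: "e \<in> {e. e dvd n}"
    hence pos: "n div e > 0" using assms by (auto elim!: dvdE)
    have "(\<Sum>d | d dvd n div e. real_of_int (moebius d) * mangoldt e) =
        real_of_int (\<Sum>d | d dvd n div e. moebius d) * mangoldt e"
      by (simp add: sum_distrib_right)
    also have "\<dots> = (if n div e = 1 then mangoldt e else 0)" using sum_moebius[OF pos] by simp
    also have "n div e = 1 \<longleftrightarrow> e = n" using e assms by (auto elim!: dvdE)
    finally show "(\<Sum>d | d dvd n div e. real_of_int (moebius d) * mangoldt e) = (if e = n then mangoldt e else 0)" .
  qed
  also have "\<dots> = mangoldt n" using assms by simp
  finally show ?thesis .
qed

section \<open>Characters\<close>

text \<open>Summation by parts: the variation of the decreasing weights telescopes, so the bound on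
  the partial sums is multiplied only by the first weight.\<close>

lemma norm_sum_abel_le:
  fixes z :: "nat \<Rightarrow> complex" and f :: "nat \<Rightarrow> real"
  assumes bound: "\<And>k. norm (\<Sum>n=a..<k. z n) \<le> B"
    and dec: "\<And>n. n \<ge> a \<Longrightarrow> f (Suc n) \<le> f n" and nonneg: "\<And>n. n \<ge> a \<Longrightarrow> f n \<ge> 0"
    and "a \<le> b"
  shows "norm (\<Sum>n=a..<b. z n * of_real (f n)) \<le> B * f a"
proof -
  define s where "s = (\<lambda>k. \<Sum>n=a..<k. z n)"
  have "(\<Sum>n=a..<b. z n * of_real (f n)) =
        s b * of_real (f b) + (\<Sum>n=a..<b. s (Suc n) * of_real (f n - f (Suc n)))"
    using \<open>a \<le> b\<close>
  proof (induction b rule: dec_induct)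
    case base
    show ?case by (simp add: s_def)
  next
    case (step b)
    moreover have "s (Suc b) = s b + z b" using step by (simp add: s_def)
    ultimately show ?case by (simp add: algebra_simps)
  qed
  also have "norm \<dots> \<le> B * f b + (\<Sum>n=a..<b. B * (f n - f (Suc n)))"
  proof (intro order.trans[OF norm_triangle_ineq] add_mono order.trans[OF norm_sum] sum_mono)
    show "norm (s b * of_real (f b)) \<le> B * f b"
      using bound[of b] nonneg[of b] \<open>a \<le> b\<close> by (simp add: s_def norm_mult mult_right_mono)
    show "norm (s (Suc n) * of_real (f n - f (Suc n))) \<le> B * (f n - f (Suc n))" if "n \<in> {a..<b}" for n
      using bound[of "Suc n"] dec[of n] that unfolding norm_mult norm_of_real
      by (simp add: s_def mult_right_mono del: sum.op_ivl_Suc)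
  qed
  also have "(\<Sum>n=a..<b. B * (f n - f (Suc n))) = B * (f a - f b)"
    using \<open>a \<le> b\<close> sum_Suc_diff'[of a b "\<lambda>n. - f n"] by (simp add: sum_distrib_left[symmetric])
  finally show ?thesis by (simp add: algebra_simps)
qed

text \<open>The restriction on \<open>n\<close> ensures \<open>ln n \<ge> 1\<close>, because
  \<open>exp 1 \<le> 3\<close>.\<close>

lemma ln_over_n_decreasing: "n \<ge> 3 \<Longrightarrow> ln (real (Suc n)) / real (Suc n) \<le> ln (real n) / real n"
proof -
  assume n: "n \<ge> 3"
  have "exp 1 \<le> real n" using exp_le n by linarith
  hence "1 \<le> ln (real n)" using n by (subst ln_ge_iff) auto
  hence "real n * (ln (real (Suc n)) - ln (real n)) \<le> ln (real n)"
    using ln_Suc_diff_le[of n] n by linarith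
  hence "real n * ln (real (Suc n)) \<le> real (Suc n) * ln (real n)" by (simp add: algebra_simps)
  thus ?thesis using n by (simp add: divide_simps mult.commute)
qed

section \<open>The L-series of a nontrivial character at 1\<close>

locale nontrivial_char =
  fixes \<chi> :: "nat \<Rightarrow> complex" and q :: nat
  assumes q_pos: "q > 0"
    and mult: "\<chi> (m * n) = \<chi> m * \<chi> n"
    and period: "\<chi> (n + q) = \<chi> n"
    and one: "\<chi> 1 = 1"
    and norm_le: "norm (\<chi> n) \<le> 1"
    and sum_period: "(\<Sum>n<q. \<chi> n) = 0"
begin

text \<open>Complete periods contribute zero, so fewer than \<open>q\<close> terms of norm at most 1
  remain.\<close>

lemma norm_partial_sum_le: "norm (\<Sum>n<N. \<chi> n) \<le> real q"
proof (induction N rule: less_induct)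
  case (less N)
  show ?case
  proof (cases "N < q")
    case True
    have "norm (\<Sum>n<N. \<chi> n) \<le> (\<Sum>n<N. 1)" by (intro sum_norm_le norm_le)
    thus ?thesis using True by simp
  next
    case False
    then obtain N' where N: "N = N' + q" by (metis le_add_diff_inverse2 not_less)
    have "(\<Sum>n<N. \<chi> n) = (\<Sum>n<q. \<chi> n) + (\<Sum>n=q..<N. \<chi> n)"
      by (subst sum.union_disjoint[symmetric]) (use N in \<open>auto intro!: sum.cong\<close>)
    also have "(\<Sum>n=q..<N. \<chi> n) = (\<Sum>n<N'. \<chi> n)"
      using sum.shift_bounds_nat_ivl[of \<chi> 0 q N'] by (simp add: N period lessThan_atLeast0)
    finally show ?thesis using less[of N'] False N q_pos by (simp add: sum_period)
  qed
qed

lemma norm_interval_sum_le: "norm (\<Sum>n=a..<b. \<chi> n) \<le> 2 * real q"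
proof (cases "a \<le> b")
  case True
  have "(\<Sum>n=a..<b. \<chi> n) = (\<Sum>n<b. \<chi> n) - (\<Sum>n<a. \<chi> n)"
    using sum_diff_nat_ivl[of 0 a b \<chi>] True by (simp add: lessThan_atLeast0)
  hence "norm (\<Sum>n=a..<b. \<chi> n) \<le> norm (\<Sum>n<b. \<chi> n) + norm (\<Sum>n<a. \<chi> n)"
    by (simp only: norm_triangle_ineq4)
  thus ?thesis using norm_partial_sum_le[of a] norm_partial_sum_le[of b] by linarith
qed simp

text \<open>The partial sums of the series for \<open>L(1, \<chi>)\<close>; their convergence to
  \<open>L\<close> is shown in \<open>A_tendsto_L\<close>.\<close>

definition A :: "nat \<Rightarrow> complex" where "A N = (\<Sum>n=1..N. \<chi> n / of_nat n)"

definition L :: complex where "L = lim A"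

lemma norm_A_diff_le:
  assumes "N \<le> M"
  shows "norm (A M - A N) \<le> 2 * real q / real (Suc N)"
proof -
  have "A M - A N = (\<Sum>n=Suc N..<Suc M. \<chi> n / of_nat n)"
    using sum_diff_nat_ivl[of 1 "Suc N" "Suc M" "\<lambda>n. \<chi> n / of_nat n"] assms
    by (simp add: A_def atLeastLessThanSuc_atLeastAtMost)
  also have "\<dots> = (\<Sum>n=Suc N..<Suc M. \<chi> n * of_real (1 / real n))" by (simp add: field_simps)
  also have "norm \<dots> \<le> 2 * real q * (1 / real (Suc N))"
    using assms by (intro norm_sum_abel_le norm_interval_sum_le) (auto simp: divide_simps)
  finally show ?thesis by simp
qed

lemma A_tendsto_L: "A \<longlonglongrightarrow> L"
proof -
  have "Cauchy A"
  proof (rule metric_CauchyI)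
    fix e :: real assume e: "e > 0"
    obtain N where N: "4 * real q / e < real N" using reals_Archimedean2 by blast
    hence small: "2 * (2 * real q / real (Suc N)) < e" using e by (simp add: field_simps)
    have "dist (A m) (A n) < e" if "m \<ge> N" "n \<ge> N" for m n
    proof -
      have "dist (A m) (A n) \<le> norm (A m - A N) + norm (A n - A N)"
        by (metis dist_norm dist_triangle2)
      also have "\<dots> \<le> 2 * (2 * real q / real (Suc N))"
        using norm_A_diff_le[OF that(1)] norm_A_diff_le[OF that(2)] by linarith
      finally show ?thesis using small by linarith
    qed
    thus "\<exists>M. \<forall>m\<ge>M. \<forall>n\<ge>M. dist (A m) (A n) < e" by blast
  qed
  thus ?thesis unfolding L_def by (simp add: Cauchy_convergent convergent_LIMSEQ_iff[symmetric])
qed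

lemma norm_L_diff_le: "norm (A N - L) \<le> 2 * real q / real (Suc N)"
proof -
  have "(\<lambda>M. norm (A M - A N)) \<longlonglongrightarrow> norm (L - A N)"
    by (intro tendsto_intros A_tendsto_L)
  hence "norm (L - A N) \<le> 2 * real q / real (Suc N)"
    by (rule LIMSEQ_le_const2) (use norm_A_diff_le in blast)
  thus ?thesis by (simp add: norm_minus_commute)
qed

lemma norm_L_diff_div_le:
  assumes "d \<in> {1..X}"
  shows "norm (A (X div d) - L) \<le> 2 * real q * real d / real X"
proof -
  have "real X < real d * real (Suc (X div d))"
    using div_bounds_real(3)[of d X] assms by (simp add: add.commute)
  hence "2 * real q / real (Suc (X div d)) \<le> 2 * real q * real d / real X"
    using assms by (simp add: divide_simps mult_left_mono)
  thus ?thesis using norm_L_diff_le[of "X div d"] by linarith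
qed

lemma norm_sum_char_ln_le:
  "\<exists>B. \<forall>X. norm (\<Sum>n=1..X. \<chi> n / of_nat n * of_real (ln (real n))) \<le> B"
proof -
  define g where "g = (\<lambda>n. \<chi> n / of_nat n * of_real (ln (real n)))"
  have g2: "norm (g n) \<le> 1" if "n \<in> {1..2}" for n
  proof -
    have "norm (g n) = norm (\<chi> n) * (ln (real n) / real n)"
      using that by (simp add: g_def norm_mult norm_divide)
    also have "\<dots> \<le> 1 * 1"
      using that ln_le_minus_one[of "real n"] norm_le by (intro mult_mono) (auto simp: divide_simps)
    finally show ?thesis by simp
  qed
  have "norm (\<Sum>n=1..X. g n) \<le> 2 + 2 * real q * (ln 3 / 3)" for X
  proof (cases "X \<le> 2")
    case True
    have "norm (\<Sum>n=1..X. g n) \<le> (\<Sum>n=1..X. 1)" using True by (intro sum_norm_le g2) auto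
    thus ?thesis using True by (simp add: add_increasing2)
  next
    case False
    \<comment> \<open>The first two terms are split off because \<open>ln n / n\<close> decreases
      only from 3 on.\<close>
    have "(\<Sum>n=1..X. g n) = (\<Sum>n=1..(2::nat). g n) + (\<Sum>n=3..<Suc X. g n)"
      by (subst sum.union_disjoint[symmetric]) (use False in \<open>auto intro!: sum.cong\<close>)
    moreover have "norm (\<Sum>n=1..2. g n) \<le> (\<Sum>n=1..(2::nat). 1)" by (intro sum_norm_le g2) auto
    moreover have "norm (\<Sum>n=3..<Suc X. \<chi> n * of_real (ln (real n) / real n)) \<le> 2 * real q * (ln (real 3) / real 3)"
      using False by (intro norm_sum_abel_le norm_interval_sum_le ln_over_n_decreasing) auto
    moreover have "(\<Sum>n=3..<Suc X. \<chi> n * of_real (ln (real n) / real n)) = (\<Sum>n=3..<Suc X. g n)"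
      by (simp add: g_def field_simps)
    ultimately show ?thesis
      using norm_triangle_ineq[of "\<Sum>n=1..2. g n" "\<Sum>n=3..<Suc X. g n"] by simp
  qed
  thus ?thesis unfolding g_def by blast
qed

text \<open>Partial sums of the series for the negative logarithmic derivative of the L-series at
  1.\<close>

definition T :: "nat \<Rightarrow> complex" where "T X = (\<Sum>n=1..X. \<chi> n * mangoldt n / of_nat n)"

lemma convolution_sum:
  "(\<Sum>n=1..X. \<chi> n / of_nat n * (\<Sum>d | d dvd n. h d)) =
   (\<Sum>d=1..X. \<chi> d / of_nat d * h d * A (X div d))"
proof -
  have "(\<Sum>n=1..X. \<chi> n / of_nat n * (\<Sum>d | d dvd n. h d)) =
        (\<Sum>n=1..X. \<Sum>d | d dvd n. \<chi> d / of_nat d * h d * (\<chi> (n div d) / of_nat (n div d)))"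
  proof (intro sum.cong refl)
    fix n assume n: "n \<in> {1..X}"
    show "\<chi> n / of_nat n * (\<Sum>d | d dvd n. h d) =
          (\<Sum>d | d dvd n. \<chi> d / of_nat d * h d * (\<chi> (n div d) / of_nat (n div d)))"
      unfolding sum_distrib_left
    proof (intro sum.cong refl)
      fix d assume "d \<in> {d. d dvd n}"
      then obtain m where "n = d * m" by (auto elim: dvdE)
      thus "\<chi> n / of_nat n * h d = \<chi> d / of_nat d * h d * (\<chi> (n div d) / of_nat (n div d))"
        using n by (simp add: mult)
    qed
  qed
  also have "\<dots> = (\<Sum>d=1..X. \<Sum>m=1..X div d. \<chi> d / of_nat d * h d * (\<chi> m / of_nat m))"
    by (rule sum_divisors_swap)
  finally show ?thesis by (simp add: A_def sum_distrib_left)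
qed

text \<open>Expanding \<open>ln\<close> as a divisor sum of \<open>mangoldt\<close> turns the
  bounded sum of \<open>\<chi> n * ln n / n\<close> into the sum of
  \<open>\<chi> d * mangoldt d / d * A (X div d)\<close>. Replacing \<open>A\<close> by its limit
  leaves \<open>L * T X\<close> and costs at most \<open>mangoldt d * 2 * q / X\<close> in the term
  of \<open>d\<close>, in total at most \<open>8 * q\<close> by Chebyshev's bound.\<close>

lemma T_bounded_if_L_nonzero:
  assumes "L \<noteq> 0"
  shows "\<exists>B. \<forall>X>0. norm (T X) \<le> B"
proof -
  obtain B where B: "\<And>X. norm (\<Sum>n=1..X. \<chi> n / of_nat n * of_real (ln (real n))) \<le> B"
    using norm_sum_char_ln_le by blast
  have "norm (L * T X) \<le> B + 8 * real q" if X: "X > 0" for X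
  proof -
    let ?S = "\<Sum>n=1..X. \<chi> n / of_nat n * of_real (ln (real n))"
    have "?S = (\<Sum>n=1..X. \<chi> n / of_nat n * (\<Sum>d | d dvd n. mangoldt d))"
      by (intro sum.cong refl) (simp add: mangoldt_sum)
    also have "\<dots> = (\<Sum>d=1..X. \<chi> d / of_nat d * mangoldt d * A (X div d))"
      by (rule convolution_sum)
    also have "\<dots> = L * T X + (\<Sum>d=1..X. \<chi> d / of_nat d * mangoldt d * (A (X div d) - L))"
      unfolding T_def sum_distrib_left sum.distrib[symmetric]
      by (intro sum.cong refl) (simp add: field_simps)
    finally have "L * T X = ?S - (\<Sum>d=1..X. \<chi> d / of_nat d * mangoldt d * (A (X div d) - L))" by simp
    hence "norm (L * T X) \<le> norm ?S + norm (\<Sum>d=1..X. \<chi> d / of_nat d * mangoldt d * (A (X div d) - L))"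
      by (simp only: norm_triangle_ineq4)
    also have "norm (\<Sum>d=1..X. \<chi> d / of_nat d * mangoldt d * (A (X div d) - L)) \<le>
        (\<Sum>d=1..X. mangoldt d * (2 * real q / real X))"
    proof (intro sum_norm_le)
      fix d assume d: "d \<in> {1..X}"
      have "norm (\<chi> d / of_nat d * mangoldt d * (A (X div d) - L)) =
          norm (\<chi> d) * (mangoldt d * (norm (A (X div d) - L) / real d))"
        by (simp add: norm_mult norm_divide)
      also have "\<dots> \<le> 1 * (mangoldt d * (2 * real q / real X))"
        using norm_le[of d] norm_L_diff_div_le[OF d] d mangoldt_nonneg[of d]
        by (intro mult_mono) (auto simp: field_simps)
      finally show "norm (\<chi> d / of_nat d * mangoldt d * (A (X div d) - L)) \<le> mangoldt d * (2 * real q / real X)"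
        by simp
    qed
    also have "\<dots> = (\<Sum>d=1..X. mangoldt d) * (2 * real q / real X)" by (rule sum_distrib_right[symmetric])
    also have "\<dots> \<le> (4 * real X) * (2 * real q / real X)" by (intro mult_right_mono psi_le) auto
    finally show ?thesis using B[of X] X by simp
  qed
  hence "norm (T X) \<le> (B + 8 * real q) / norm L" if "X > 0" for X
    using that assms by (simp add: norm_mult field_simps)
  thus ?thesis by blast
qed

text \<open>Moebius inversion with the weights \<open>moebius d * ln (X / d)\<close> produces
  \<open>mangoldt n\<close>, plus \<open>ln X\<close> when \<open>n = 1\<close>, so the convolution
  equals \<open>T X + ln X\<close>. As \<open>L = 0\<close>, each \<open>A (X div d)\<close> is
  itself small, and \<open>X * ln X - ln (fact X) \<le> X\<close> bounds the total.\<close>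

lemma T_if_L_zero:
  assumes "L = 0" "X > 0"
  shows "norm (T X + of_real (ln (real X))) \<le> 2 * real q"
proof -
  define h where "h = (\<lambda>d. of_int (moebius d) * of_real (ln (real X / real d)) :: complex)"
  have "(\<Sum>d | d dvd n. h d) = mangoldt n + (if n = 1 then of_real (ln (real X)) else 0)"
    if n: "n \<in> {1..X}" for n
  proof -
    have "(\<Sum>d | d dvd n. real_of_int (moebius d) * ln (real X / real d)) =
      (\<Sum>d | d dvd n. real_of_int (moebius d) * ln (real (n div d)) +
          real_of_int (moebius d) * ln (real X / real n))"
    proof (intro sum.cong refl)
      fix d assume "d \<in> {d. d dvd n}"
      then obtain m where m: "n = d * m" by (auto elim: dvdE)
      hence "ln (real X / real d) = ln (real m) + ln (real X / real n)"
        using n assms by (simp add: ln_div ln_mult)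
      thus "real_of_int (moebius d) * ln (real X / real d) = real_of_int (moebius d) * ln (real (n div d)) +
          real_of_int (moebius d) * ln (real X / real n)" using m n by (simp add: algebra_simps)
    qed
    also have "\<dots> = mangoldt n + real_of_int (\<Sum>d | d dvd n. moebius d) * ln (real X / real n)"
      using n mangoldt_conv_moebius[of n] by (simp add: sum.distrib sum_distrib_right)
    also have "\<dots> = mangoldt n + (if n = 1 then ln (real X) else 0)"
      using n sum_moebius[of n] by simp
    finally have "of_real (\<Sum>d | d dvd n. real_of_int (moebius d) * ln (real X / real d)) =
      (of_real (mangoldt n + (if n = 1 then ln (real X) else 0)) :: complex)" by (rule arg_cong)
    thus ?thesis by (simp add: h_def)
  qed
  hence "(\<Sum>n=1..X. \<chi> n / of_nat n * (\<Sum>d | d dvd n. h d)) =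
     (\<Sum>n=1..X. \<chi> n * mangoldt n / of_nat n + (if n = 1 then of_real (ln (real X)) else 0))"
    using one by (intro sum.cong refl) (auto simp: algebra_simps)
  also have "\<dots> = T X + of_real (ln (real X))"
    using assms(2) by (simp add: sum.distrib T_def Suc_le_eq)
  finally have "norm (T X + of_real (ln (real X))) =
      norm (\<Sum>d=1..X. \<chi> d / of_nat d * h d * A (X div d))" by (simp only: convolution_sum)
  also have "\<dots> \<le> (\<Sum>d=1..X. (ln (real X) - ln (real d)) * (2 * real q / real X))"
  proof (intro sum_norm_le)
    fix d assume d: "d \<in> {1..X}"
    have ln: "ln (real X / real d) = ln (real X) - ln (real d)" using d by (simp add: ln_div)
    have "ln (real d) \<le> ln (real X)" using d by simp
    hence "norm (\<chi> d / of_nat d * h d * A (X div d)) =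
        norm (\<chi> d) * (\<bar>real_of_int (moebius d)\<bar> * ((ln (real X) - ln (real d)) * (norm (A (X div d)) / real d)))"
      unfolding h_def ln norm_mult norm_divide norm_of_real by simp
    also have "\<dots> \<le> 1 * (1 * ((ln (real X) - ln (real d)) * (2 * real q / real X)))"
    proof (intro mult_mono norm_le)
      show "\<bar>real_of_int (moebius d)\<bar> \<le> 1" using abs_moebius_le[of d] by linarith
      show "norm (A (X div d)) / real d \<le> 2 * real q / real X"
        using norm_L_diff_div_le[OF d] assms d by (simp add: field_simps)
    qed (use \<open>ln (real d) \<le> ln (real X)\<close> in auto)
    finally show "norm (\<chi> d / of_nat d * h d * A (X div d)) \<le> (ln (real X) - ln (real d)) * (2 * real q / real X)"
      by simp
  qed
  also have "\<dots> = (real X * ln (real X) - ln (fact X)) * (2 * real q / real X)"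
    unfolding sum_distrib_right[symmetric] sum_subtractf ln_fact_eq_sum by simp
  also have "\<dots> \<le> real X * (2 * real q / real X)"
    using ln_fact_ge[of X] by (intro mult_right_mono) auto
  finally show ?thesis using assms(2) by simp
qed

end

section \<open>The characters modulo a power of 3\<close>

locale power_of_3_chars =
  fixes j g :: nat
  assumes j: "j > 0" and primroot: "residue_primroot (3 ^ j) g"
begin

definition q :: nat where "q = 3 ^ j"

definition \<phi> :: nat where "\<phi> = totient q"

lemma q_ge: "q \<ge> 3" using j unfolding q_def by (cases j) auto

lemma q_gt_1: "q > 1" using q_ge by simp

lemma coprime_q_iff: "coprime n q \<longleftrightarrow> \<not> 3 dvd n"
proof -
  have "prime (3::nat)" by simp
  hence "coprime 3 n \<longleftrightarrow> \<not> 3 dvd n"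
    by (metis coprime_absorb_left not_prime_unit prime_imp_coprime)
  thus ?thesis using j by (simp add: q_def coprime_commute)
qed

lemma primroot_q: "coprime q g" "ord q g = \<phi>"
  using primroot by (auto simp: residue_primroot_def q_def \<phi>_def)

lemma phi_pos: "\<phi> > 0" using q_gt_1 by (simp add: \<phi>_def)

definition \<omega> :: complex where "\<omega> = cis (2 * pi / real \<phi>)"

lemma omega_pow: "\<omega> ^ k = cis (2 * pi * real k / real \<phi>)"
  by (simp add: \<omega>_def DeMoivre mult_ac)

lemma omega_pow_phi: "\<omega> ^ \<phi> = 1"
  using phi_pos by (simp add: omega_pow)

lemma norm_omega_pow: "norm (\<omega> ^ k) = 1"
  by (simp add: omega_pow)

lemma omega_pow_mod: "\<omega> ^ (k mod \<phi>) = \<omega> ^ k"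
proof -
  have "\<omega> ^ k = \<omega> ^ (\<phi> * (k div \<phi>) + k mod \<phi>)" by simp
  also have "\<dots> = \<omega> ^ (k mod \<phi>)" unfolding power_add power_mult omega_pow_phi by simp
  finally show ?thesis by simp
qed

lemma omega_pow_cong: "[a = b] (mod \<phi>) \<Longrightarrow> \<omega> ^ a = \<omega> ^ b"
  by (metis omega_pow_mod cong_def)

lemma omega_pow_neq_1: "0 < k \<Longrightarrow> k < \<phi> \<Longrightarrow> \<omega> ^ k \<noteq> 1"
proof
  assume k: "0 < k" "k < \<phi>" and "\<omega> ^ k = 1"
  hence "cis (2 * pi * real k / real \<phi>) = cis (2 * pi * real 0 / real \<phi>)" by (simp add: omega_pow)
  moreover have "inj_on (\<lambda>k. cis (2 * pi * real k / real \<phi>)) {..<\<phi>}"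
    using bij_betw_roots_unity[OF phi_pos] by (rule bij_betw_imp_inj_on)
  ultimately show False using k inj_onD[of _ "{..<\<phi>}" k 0] by fastforce
qed

lemma sum_powers_root_of_unity:
  assumes "(z :: complex) ^ \<phi> = 1" "z \<noteq> 1"
  shows "(\<Sum>i<\<phi>. z ^ i) = 0"
  using assms by (simp add: geometric_sum)

text \<open>The discrete logarithm to base \<open>g\<close> modulo \<open>q\<close>, meaningful for
  \<open>n\<close> coprime to \<open>q\<close>.\<close>

definition ind :: "nat \<Rightarrow> nat" where
  "ind n = (SOME i. i < \<phi> \<and> g ^ i mod q = n mod q)"

lemma ind:
  assumes "coprime n q"
  shows "ind n < \<phi>" "g ^ ind n mod q = n mod q"
proof -
  have "n mod q \<in> totatives q"
    using assms q_gt_1 by (auto simp: totatives_def mod_greater_zero_iff_not_dvd coprime_absorb_right)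
  then obtain i where "i < \<phi>" "g ^ i mod q = n mod q"
    using residue_primroot_is_generator[OF q_gt_1, of g] primroot
    by (force simp: bij_betw_def q_def \<phi>_def)
  thus "ind n < \<phi>" "g ^ ind n mod q = n mod q" unfolding ind_def
    using someI[of "\<lambda>i. i < \<phi> \<and> g ^ i mod q = n mod q" i] by auto
qed

lemma ind_cong_iff: "coprime n q \<Longrightarrow> g ^ i mod q = n mod q \<longleftrightarrow> [ind n = i] (mod \<phi>)"
  using order_divides_expdiff[OF primroot_q(1), of "ind n" i] ind(2)[of n] primroot_q(2)
  by (auto simp: cong_def)

text \<open>Since \<open>g\<close> generates the unit group modulo \<open>q\<close>, these are all
  the Dirichlet characters modulo \<open>q\<close> as \<open>k\<close> runs below
  \<open>\<phi>\<close>; the principal one is \<open>k = 0\<close>.\<close>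

definition \<chi> :: "nat \<Rightarrow> nat \<Rightarrow> complex" where
  "\<chi> k n = (if coprime n q then \<omega> ^ (k * ind n) else 0)"

lemma chi_mult: "\<chi> k (m * n) = \<chi> k m * \<chi> k n"
proof (cases "coprime m q \<and> coprime n q")
  case True
  have "g ^ (ind m + ind n) mod q = (m * n) mod q"
    using True ind(2)[of m] ind(2)[of n] by (metis mod_mult_eq power_add)
  hence "[ind (m * n) = ind m + ind n] (mod \<phi>)" using True ind_cong_iff[of "m * n"] by simp
  hence "[k * ind (m * n) = k * (ind m + ind n)] (mod \<phi>)" by (rule cong_scalar_left)
  hence "\<omega> ^ (k * ind (m * n)) = \<omega> ^ (k * ind m) * \<omega> ^ (k * ind n)"
    by (simp add: omega_pow_cong[of _ "k * (ind m + ind n)"] distrib_left power_add)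
  thus ?thesis using True by (simp add: \<chi>_def)
qed (auto simp: \<chi>_def)

lemma ind_eq_0_iff: "coprime n q \<Longrightarrow> ind n = 0 \<longleftrightarrow> [n = 1] (mod q)"
  using ind_cong_iff[of n 0] ind(1)[of n] by (auto simp: cong_def)

lemma char_chi:
  assumes k: "0 < k" "k < \<phi>"
  shows "nontrivial_char (\<chi> k) q"
proof
  show "q > 0" using q_gt_1 by simp
  show "\<chi> k (m * n) = \<chi> k m * \<chi> k n" for m n by (rule chi_mult)
  show "\<chi> k (n + q) = \<chi> k n" for n
  proof -
    have "ind (n + q) = ind n" by (simp add: ind_def)
    moreover have "coprime (n + q) q \<longleftrightarrow> coprime n q" by (metis coprime_iff_gcd_eq_1 gcd_add1)
    ultimately show ?thesis by (simp add: \<chi>_def)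
  qed
  have "ind 1 = 0" by (subst ind_eq_0_iff) auto
  thus "\<chi> k 1 = 1" by (simp add: \<chi>_def)
  show "norm (\<chi> k n) \<le> 1" for n by (simp add: \<chi>_def norm_omega_pow)
  have "(\<Sum>n<q. \<chi> k n) = (\<Sum>n\<in>totatives q. \<chi> k n)"
  proof (rule sum.mono_neutral_right)
    show "totatives q \<subseteq> {..<q}" using q_gt_1 totatives_less by blast
    show "\<forall>n\<in>{..<q} - totatives q. \<chi> k n = 0"
      using q_gt_1 by (auto simp: totatives_def \<chi>_def)
  qed auto
  also have "\<dots> = (\<Sum>i<\<phi>. \<chi> k (g ^ i mod q))"
    using sum.reindex_bij_betw[OF residue_primroot_is_generator[OF q_gt_1, of g], of "\<chi> k"] primroot
    by (simp add: q_def \<phi>_def)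
  also have "\<dots> = (\<Sum>i<\<phi>. (\<omega> ^ k) ^ i)"
  proof (intro sum.cong refl)
    fix i
    have cop: "coprime (g ^ i mod q) q" using primroot_q(1) q_gt_1
      by (simp add: coprime_commute)
    have "[ind (g ^ i mod q) = i] (mod \<phi>)" using ind_cong_iff[OF cop, of i] by simp
    hence "[k * ind (g ^ i mod q) = k * i] (mod \<phi>)" by (rule cong_scalar_left)
    thus "\<chi> k (g ^ i mod q) = (\<omega> ^ k) ^ i"
      using cop omega_pow_cong by (simp add: \<chi>_def power_mult[symmetric])
  qed
  also have "\<dots> = 0"
  proof (rule sum_powers_root_of_unity)
    have "(\<omega> ^ k) ^ \<phi> = (\<omega> ^ \<phi>) ^ k" by (simp add: power_mult[symmetric] mult.commute)
    thus "(\<omega> ^ k) ^ \<phi> = 1" by (simp add: omega_pow_phi)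
  qed (rule omega_pow_neq_1[OF k])
  finally show "(\<Sum>n<q. \<chi> k n) = 0" .
qed

text \<open>Orthogonality: the sum is geometric in the root of unity
  \<open>\<omega> ^ ind n\<close>, which is 1 only when \<open>ind n = 0\<close>.\<close>

lemma sum_chi:
  "(\<Sum>k<\<phi>. \<chi> k n) = (if [n = 1] (mod q) then of_nat \<phi> else 0)"
proof (cases "coprime n q")
  case True
  have "(\<Sum>k<\<phi>. \<chi> k n) = (\<Sum>k<\<phi>. (\<omega> ^ ind n) ^ k)"
    using True by (simp add: \<chi>_def power_mult[symmetric] mult.commute)
  also have "\<dots> = (if [n = 1] (mod q) then of_nat \<phi> else 0)"
  proof (cases "ind n = 0")
    case False
    have "(\<omega> ^ ind n) ^ \<phi> = (\<omega> ^ \<phi>) ^ ind n" by (simp add: power_mult[symmetric] mult.commute)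
    thus ?thesis using False ind_eq_0_iff[OF True] ind(1)[OF True] omega_pow_neq_1
      by (subst sum_powers_root_of_unity) (auto simp: omega_pow_phi)
  qed (use ind_eq_0_iff[OF True] in auto)
  finally show ?thesis .
next
  case False
  hence "\<not> [n = 1] (mod q)" by (metis cong_imp_coprime cong_sym coprime_1_left)
  thus ?thesis using False by (simp add: \<chi>_def)
qed

definition T :: "nat \<Rightarrow> nat \<Rightarrow> complex" where "T k X = (\<Sum>n=1..X. \<chi> k n * mangoldt n / of_nat n)"

lemma sum_T:
  "(\<Sum>k<\<phi>. Re (T k X)) = real \<phi> * (\<Sum>n | n \<in> {1..X} \<and> [n = 1] (mod q). mangoldt n / real n)"
proof -
  have "(\<Sum>k<\<phi>. T k X) = (\<Sum>n=1..X. (\<Sum>k<\<phi>. \<chi> k n) * mangoldt n / of_nat n)"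
    unfolding T_def by (subst sum.swap) (simp add: sum_distrib_right sum_divide_distrib)
  also have "\<dots> = (\<Sum>n=1..X. if [n = 1] (mod q) then of_nat \<phi> * mangoldt n / of_nat n else 0)"
    by (intro sum.cong) (auto simp: sum_chi)
  also have "\<dots> = (\<Sum>n | n \<in> {1..X} \<and> [n = 1] (mod q). of_nat \<phi> * mangoldt n / of_nat n)"
    by (subst sum.inter_filter[symmetric]) auto
  also have "\<dots> = of_real (\<Sum>n | n \<in> {1..X} \<and> [n = 1] (mod q). real \<phi> * mangoldt n / real n)"
    by simp
  finally have "(\<Sum>k<\<phi>. Re (T k X)) = (\<Sum>n | n \<in> {1..X} \<and> [n = 1] (mod q). real \<phi> * mangoldt n / real n)"
    by (metis Re_complex_of_real Re_sum)
  thus ?thesis by (simp add: sum_distrib_left)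
qed

lemma Re_T_0: "Re (T 0 X) = (\<Sum>n | n \<in> {1..X} \<and> coprime n q. mangoldt n / real n)"
proof -
  have "T 0 X = (\<Sum>n=1..X. if coprime n q then mangoldt n / of_nat n else 0)"
    unfolding T_def by (intro sum.cong) (auto simp: \<chi>_def)
  also have "\<dots> = (\<Sum>n | n \<in> {1..X} \<and> coprime n q. mangoldt n / of_nat n)"
    by (subst sum.inter_filter[symmetric]) auto
  also have "\<dots> = of_real (\<Sum>n | n \<in> {1..X} \<and> coprime n q. mangoldt n / real n)" by simp
  finally show ?thesis by (metis Re_complex_of_real)
qed

lemma Re_T_0_le: "X > 0 \<Longrightarrow> Re (T 0 X) \<le> ln (real X) + 4"
proof -
  assume X: "X > 0"
  have "Re (T 0 X) \<le> (\<Sum>n=1..X. mangoldt n / real n)"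
    unfolding Re_T_0 by (intro sum_mono2) (auto intro!: divide_nonneg_nonneg mangoldt_nonneg)
  thus ?thesis using mertens_upper[OF X] by linarith
qed

text \<open>The principal character removes only the powers of 3 from Mertens' sum, and their
  contributions add up to at most 2.\<close>

lemma Re_T_0_ge: "X > 0 \<Longrightarrow> Re (T 0 X) \<ge> ln (real X) - 3"
proof -
  assume X: "X > 0"
  have nonneg: "0 \<le> mangoldt n / real n" for n
    by (intro divide_nonneg_nonneg mangoldt_nonneg) auto
  have "(\<Sum>n=1..X. mangoldt n / real n) = (\<Sum>n | n \<in> {1..X} \<and> coprime n q. mangoldt n / real n) +
      (\<Sum>n | n \<in> {1..X} \<and> \<not> coprime n q. mangoldt n / real n)"
    by (subst sum.union_disjoint[symmetric]) (auto intro!: sum.cong)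
  moreover have "(\<Sum>n | n \<in> {1..X} \<and> \<not> coprime n q. mangoldt n / real n) \<le> 2"
  proof -
    have "(\<Sum>n | n \<in> {1..X} \<and> \<not> coprime n q. mangoldt n / real n) \<le>
        (\<Sum>n\<in>(\<lambda>i. 3 ^ i) ` {1..X}. mangoldt n / real n)"
    proof -
      have "(\<Sum>n | n \<in> {1..X} \<and> \<not> coprime n q. mangoldt n / real n) =
          (\<Sum>n | n \<in> {1..X} \<and> \<not> coprime n q \<and> primepow n. mangoldt n / real n)"
        by (rule sum.mono_neutral_right) (auto simp: mangoldt_def)
      also have "\<dots> \<le> (\<Sum>n\<in>(\<lambda>i. 3 ^ i) ` {1..X}. mangoldt n / real n)"
      proof (rule sum_mono2)
        show "{n. n \<in> {1..X} \<and> \<not> coprime n q \<and> primepow n} \<subseteq> (\<lambda>i. 3 ^ i) ` {1..X}"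
        proof
          fix n assume "n \<in> {n. n \<in> {1..X} \<and> \<not> coprime n q \<and> primepow n}"
          hence n: "n \<le> X" "3 dvd n" "primepow n" by (auto simp: coprime_q_iff)
          then obtain p i where p: "prime p" "i > 0" "n = p ^ i" by (auto simp: primepow_def)
          hence "p = 3" using n(2) prime_dvd_power[of 3 p i] primes_dvd_imp_eq[of 3 p] by simp
          moreover have "i < 3 ^ i" by (rule power_gt_expt) simp
          ultimately show "n \<in> (\<lambda>i. 3 ^ i) ` {1..X}" using p n by auto
        qed
      qed (use nonneg in auto)
      finally show ?thesis .
    qed
    also have "\<dots> = (\<Sum>i=1..X. mangoldt (3 ^ i) / real (3 ^ i))"
      by (subst sum.reindex) (auto simp: inj_on_def)
    also have "\<dots> = (\<Sum>i=1..X. ln 3 / 3 ^ i)"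
      by (intro sum.cong refl) (simp add: mangoldt_primepow)
    also have "\<dots> \<le> ln 3 * (1 - 1 / 3 ^ X)"
    proof (induction X)
      case (Suc X)
      have "ln (3::real) * (1 / 3 ^ Suc X) \<le> ln 3 * (1 / 3 ^ X - 1 / 3 ^ Suc X)"
        by (intro mult_left_mono) (auto simp: field_simps)
      thus ?case using Suc by (simp add: right_diff_distrib)
    qed simp
    also have "\<dots> \<le> 2 * 1" using ln_le_minus_one[of "3::real"] by (intro mult_mono) auto
    finally show ?thesis by simp
  qed
  ultimately show ?thesis using mertens_lower[OF X] by (simp add: Re_T_0)
qed

section \<open>Nonvanishing at 1: the quadratic character and conjugate pairs\<close>

lemma chi_conj:
  assumes "k \<le> \<phi>"
  shows "\<chi> (\<phi> - k) n = cnj (\<chi> k n)"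
proof (cases "coprime n q")
  case True
  define z where "z = \<omega> ^ (k * ind n)"
  have nz: "norm z = 1" unfolding z_def by (rule norm_omega_pow)
  have "(\<phi> - k) * ind n + k * ind n = \<phi> * ind n"
    using assms by (simp add: distrib_right[symmetric])
  hence "\<omega> ^ ((\<phi> - k) * ind n) * z = (\<omega> ^ \<phi>) ^ ind n"
    unfolding z_def by (simp add: power_add[symmetric] power_mult[symmetric])
  also have "\<dots> = cnj z * z" using nz complex_norm_square[of z] by (simp add: omega_pow_phi mult.commute)
  finally have "\<omega> ^ ((\<phi> - k) * ind n) * z = cnj z * z" .
  moreover have "z \<noteq> 0" using nz by auto
  ultimately have "\<omega> ^ ((\<phi> - k) * ind n) = cnj z" by simp
  thus ?thesis using True by (simp add: \<chi>_def z_def)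
qed (simp add: \<chi>_def)

lemma Re_T_conj: "k \<le> \<phi> \<Longrightarrow> Re (T (\<phi> - k) X) = Re (T k X)"
proof -
  assume k: "k \<le> \<phi>"
  have "cnj (mangoldt n) = mangoldt n" for n by (simp add: mangoldt_def)
  hence "T (\<phi> - k) X = cnj (T k X)" by (simp add: T_def chi_conj[OF k])
  thus ?thesis by simp
qed

text \<open>As 2 is a power of \<open>g\<close> modulo 3, the residue 1 is excluded; coprimality
  excludes 0.\<close>

lemma g_mod_3: "g mod 3 = 2"
proof -
  have three: "3 dvd q" using j by (simp add: q_def)
  have "coprime 2 q" by (subst coprime_q_iff) auto
  from ind(2)[OF this] have "g ^ ind 2 mod 3 = 2 mod 3" using three by (metis mod_mod_cancel)
  hence "(g mod 3) ^ ind 2 mod 3 = 2" by (simp add: power_mod)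
  moreover have "\<not> 3 dvd g" using primroot_q(1) coprime_q_iff coprime_commute by blast
  ultimately have "g mod 3 \<noteq> 1" "g mod 3 \<noteq> 0" by (auto simp: mod_greater_zero_iff_not_dvd)
  moreover have "g mod 3 < 3" by simp
  ultimately show ?thesis by linarith
qed

lemma g_pow_mod_3: "g ^ i mod 3 = (if even i then 1 else 2)"
proof (induction i)
  case (Suc i)
  have "g ^ Suc i mod 3 = ((g mod 3) * (g ^ i mod 3)) mod 3" by (simp add: mod_mult_eq)
  thus ?case using Suc by (simp add: g_mod_3)
qed simp

text \<open>Here \<open>\<omega> ^ k\<close> is \<open>-1\<close>, so \<open>\<chi> k n\<close> is
  the sign given by the parity of \<open>ind n\<close>, and this parity can be read off modulo 3
  because \<open>g\<close> is 2 modulo 3.\<close>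

lemma chi_quadratic:
  assumes "2 * k = \<phi>" "0 < k"
  shows "\<chi> k n = (if n mod 3 = 0 then 0 else if n mod 3 = 1 then 1 else -1)"
proof (cases "coprime n q")
  case True
  have "(\<omega> ^ k) ^ 2 = 1" using assms(1) omega_pow_phi by (simp add: power_mult[symmetric] mult.commute)
  moreover have "\<omega> ^ k \<noteq> 1" using assms by (intro omega_pow_neq_1) auto
  ultimately have "\<omega> ^ k = -1" by (simp add: power2_eq_1_iff)
  hence "\<chi> k n = (-1) ^ ind n" using True by (simp add: \<chi>_def power_mult)
  moreover have "n mod 3 = g ^ ind n mod 3"
    using ind(2)[OF True] j by (metis dvd_power mod_mod_cancel q_def)
  ultimately show ?thesis using True by (auto simp: g_pow_mod_3)
next
  case False
  thus ?thesis by (simp add: \<chi>_def coprime_q_iff mod_eq_0_iff_dvd)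
qed

text \<open>The series is \<open>1 - 1/2 + 1/4 - 1/5 + ...\<close>; its partial sums at multiples of
  3 increase from \<open>1/2\<close>, so the limit cannot be 0.\<close>

lemma L_nonzero_quadratic:
  assumes "2 * k = \<phi>" "0 < k"
  shows "nontrivial_char.L (\<chi> k) \<noteq> 0"
proof
  interpret c: nontrivial_char "\<chi> k" q using assms by (intro char_chi) auto
  assume L0: "c.L = 0"
  have "Re (c.A (3 * Suc m)) \<ge> 1 / 2" for m
  proof (induction m)
    case 0
    have "{1..3::nat} = {1,2,3}" by auto
    thus ?case unfolding c.A_def by (simp add: chi_quadratic[OF assms])
  next
    case (Suc m)
    have "c.A (3 * Suc (Suc m)) = c.A (3 * Suc m) + 1 / of_nat (3 * m + 4) - 1 / of_nat (3 * m + 5)"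
    proof -
      have 1: "3 * Suc (Suc m) = Suc (Suc (Suc (3 * Suc m)))" by simp
      have 2: "c.A (Suc n) = c.A n + \<chi> k (Suc n) / of_nat (Suc n)" for n by (simp add: c.A_def)
      have 3: "\<chi> k (Suc (Suc (Suc (3 * Suc m)))) = 0" "\<chi> k (Suc (Suc (3 * Suc m))) = -1"
        "\<chi> k (Suc (3 * Suc m)) = 1"
        unfolding chi_quadratic[OF assms] by (simp_all add: mod_Suc)
      have 4: "Suc (3 * Suc m) = 3 * m + 4" "Suc (Suc (3 * Suc m)) = 3 * m + 5" by simp_all
      have "c.A (3 * Suc (Suc m)) = c.A (3 * Suc m) + 1 / of_nat (Suc (3 * Suc m)) +
          (- 1) / of_nat (Suc (Suc (3 * Suc m))) + 0 / of_nat (Suc (Suc (Suc (3 * Suc m))))"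
        by (simp only: 1 2 3)
      thus ?thesis unfolding 4 by simp
    qed
    hence "c.A (3 * Suc (Suc m)) = c.A (3 * Suc m) + of_real (1 / real (3 * m + 4) - 1 / real (3 * m + 5))"
      by simp
    hence "Re (c.A (3 * Suc (Suc m))) = Re (c.A (3 * Suc m)) + (1 / real (3 * m + 4) - 1 / real (3 * m + 5))"
      by (simp only: plus_complex.sel Re_complex_of_real)
    moreover have "1 / real (3 * m + 5) \<le> 1 / real (3 * m + 4)" by (intro divide_left_mono) auto
    ultimately show ?case using Suc by linarith
  qed
  \<comment> \<open>If the limit were 0, the tail bound at this index would give norm at most
    \<open>2 * q / (12 * q + 4)\<close>, which is below \<open>1 / 2\<close>.\<close>
  from this[of "4 * q"] have "1 / 2 \<le> norm (c.A (3 * Suc (4 * q)))"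
    using complex_Re_le_cmod order.trans by blast
  also have "\<dots> \<le> 2 * real q / real (Suc (3 * Suc (4 * q)))"
    using c.norm_L_diff_le[of "3 * Suc (4 * q)"] L0 by simp
  also have "\<dots> < 1 / 2" by (simp add: field_simps)
  finally show False by simp
qed

text \<open>When \<open>L = 0\<close> the real part is \<open>- ln X\<close> up to a constant, so an
  upper bound is available before it is known whether \<open>L\<close> vanishes.\<close>

lemma Re_T_bounded_above:
  assumes "0 < k" "k < \<phi>"
  shows "\<exists>B. \<forall>X>0. Re (T k X) \<le> B"
proof -
  interpret c: nontrivial_char "\<chi> k" q by (rule char_chi[OF assms])
  have T: "c.T X = T k X" for X by (simp add: T_def c.T_def)
  show ?thesis
  proof (cases "c.L = 0")
    case True
    have "Re (T k X) \<le> 2 * real q" if "X > 0" for X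
    proof -
      have "Re (T k X + of_real (ln (real X))) \<le> 2 * real q"
        using c.T_if_L_zero[OF True that] complex_Re_le_cmod[of "T k X + of_real (ln (real X))"]
        by (simp only: T)
      moreover have "ln (real X) \<ge> 0" using that by simp
      ultimately show ?thesis by simp
    qed
    thus ?thesis by blast
  next
    case False
    then obtain B where "\<And>X. X > 0 \<Longrightarrow> norm (T k X) \<le> B"
      using c.T_bounded_if_L_nonzero T by auto
    thus ?thesis using complex_Re_le_cmod order.trans by blast
  qed
qed

text \<open>Zeros of \<open>L(1, \<chi>)\<close> for non-real \<open>\<chi>\<close> come in conjugate pairs, and two of them would
  make the nonnegative sum over all characters tend to \<open>-\<infinity>\<close>.\<close>

lemma L_nonzero:
  assumes k: "0 < k" "k < \<phi>"
  shows "nontrivial_char.L (\<chi> k) \<noteq> 0"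
proof (cases "2 * k = \<phi>")
  case True
  thus ?thesis by (intro L_nonzero_quadratic k)
next
  case False
  interpret c: nontrivial_char "\<chi> k" q by (rule char_chi[OF k])
  have T: "c.T X = T k X" for X by (simp add: T_def c.T_def)
  show ?thesis
  proof
    assume L0: "c.L = 0"
    have "\<exists>B. \<forall>l. 0 < l \<and> l < \<phi> \<longrightarrow> (\<forall>X>0. Re (T l X) \<le> B l)"
      using Re_T_bounded_above by metis
    then obtain B where B: "\<And>l X. 0 < l \<Longrightarrow> l < \<phi> \<Longrightarrow> X > 0 \<Longrightarrow> Re (T l X) \<le> B l" by blast
    define R where "R = {..<\<phi>} - {0, k, \<phi> - k}"
    have "ln (real X) \<le> 4 + 4 * real q + (\<Sum>l\<in>R. B l)" if X: "X > 0" for X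
    proof -
      have "0 \<le> (\<Sum>l<\<phi>. Re (T l X))" unfolding sum_T
        by (intro mult_nonneg_nonneg sum_nonneg divide_nonneg_nonneg mangoldt_nonneg) auto
      also have "\<dots> = (\<Sum>l\<in>{0, k, \<phi> - k}. Re (T l X)) + (\<Sum>l\<in>R. Re (T l X))"
        unfolding R_def using k by (subst sum.subset_diff[of "{0, k, \<phi> - k}"]) auto
      \<comment> \<open>The three indices are distinct because \<open>2 * k \<noteq> \<phi>\<close>.
        The conjugate pair contributes about \<open>- 2 * ln X\<close>, which outweighs the
        \<open>ln X\<close> of index 0.\<close>
      also have "(\<Sum>l\<in>{0, k, \<phi> - k}. Re (T l X)) = Re (T 0 X) + 2 * Re (T k X)"
        using k False Re_T_conj[of k X] by auto
      also have "Re (T 0 X) \<le> ln (real X) + 4" by (rule Re_T_0_le[OF X])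
      also have "Re (T k X) \<le> 2 * real q - ln (real X)"
        using c.T_if_L_zero[OF L0 X] complex_Re_le_cmod[of "T k X + of_real (ln (real X))"] by (simp add: T)
      also have "(\<Sum>l\<in>R. Re (T l X)) \<le> (\<Sum>l\<in>R. B l)"
        using X by (intro sum_mono B) (auto simp: R_def intro: Nat.gr0I)
      finally show ?thesis by simp
    qed
    note bounded = this
    define D where "D = 4 + 4 * real q + (\<Sum>l\<in>R. B l)"
    obtain X :: nat where X: "exp (D + 1) < real X" using reals_Archimedean2 by blast
    hence "real X > 0" using exp_gt_zero[of "D + 1"] by linarith
    hence "D + 1 \<le> ln (real X)" using X by (subst ln_ge_iff) auto
    thus False using bounded[of X] \<open>real X > 0\<close> by (simp add: D_def)
  qed
qed

text \<open>By orthogonality the left side is the sum of all \<open>Re (T l X)\<close>. Index 0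
  gives \<open>ln X\<close> up to a constant, and the other indices stay bounded since their
  L-values do not vanish.\<close>

lemma progression_lower_bound:
  "\<exists>B. \<forall>X>0. real \<phi> * (\<Sum>n | n \<in> {1..X} \<and> [n = 1] (mod q). mangoldt n / real n) \<ge> ln (real X) - B"
proof -
  have "\<exists>B. \<forall>l. 0 < l \<and> l < \<phi> \<longrightarrow> (\<forall>X>0. norm (T l X) \<le> B l)"
  proof -
    have "\<exists>B. \<forall>X>0. norm (T l X) \<le> B" if l: "0 < l" "l < \<phi>" for l
    proof -
      interpret c: nontrivial_char "\<chi> l" q by (rule char_chi[OF l])
      have "c.T X = T l X" for X by (simp add: T_def c.T_def)
      thus ?thesis using c.T_bounded_if_L_nonzero[OF L_nonzero[OF l]] by simp
    qed
    thus ?thesis by metis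
  qed
  then obtain B where B: "\<And>l X. 0 < l \<Longrightarrow> l < \<phi> \<Longrightarrow> X > 0 \<Longrightarrow> norm (T l X) \<le> B l" by blast
  have "real \<phi> * (\<Sum>n | n \<in> {1..X} \<and> [n = 1] (mod q). mangoldt n / real n) \<ge>
      ln (real X) - (3 + (\<Sum>l\<in>{..<\<phi>} - {0}. B l))" if X: "X > 0" for X
  proof -
    have "(\<Sum>l<\<phi>. Re (T l X)) = Re (T 0 X) + (\<Sum>l\<in>{..<\<phi>} - {0}. Re (T l X))"
      using phi_pos by (subst sum.remove[of _ 0]) auto
    moreover have "(\<Sum>l\<in>{..<\<phi>} - {0}. - B l) \<le> (\<Sum>l\<in>{..<\<phi>} - {0}. Re (T l X))"
    proof (rule sum_mono)
      fix l assume "l \<in> {..<\<phi>} - {0}"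
      hence "norm (T l X) \<le> B l" using X by (intro B) auto
      thus "- B l \<le> Re (T l X)" using abs_Re_le_cmod[of "T l X"] by linarith
    qed
    ultimately show ?thesis using Re_T_0_ge[OF X] sum_T[of X] by (simp add: sum_negf)
  qed
  thus ?thesis by blast
qed

end

lemma mangoldt_progression_power_of_3:
  assumes "j > 0"
  shows "\<exists>B. \<forall>X>0. real (totient (3 ^ j)) *
     (\<Sum>n | n \<in> {1..X} \<and> [n = 1] (mod 3 ^ j). mangoldt n / real n) \<ge> ln (real X) - B"
proof -
  obtain g where "\<forall>k>0. residue_primroot (3 ^ k) g"
    using residue_primroot_odd_prime_power_exists[of 3] by auto
  then interpret power_of_3_chars j g using assms by unfold_locales auto
  show ?thesis using progression_lower_bound unfolding q_def \<phi>_def .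
qed

section \<open>Primes \<open>p\<close> with \<open>p - 1\<close> dividing a given number\<close>

lemma sum_ln_over_square_le: "(\<Sum>p=2..Y. ln (real p) / (real p * (real p - 1))) \<le> 4"
proof -
  \<comment> \<open>The subtracted term majorizes the tail and carries the induction: its decrease
    from \<open>Y\<close> to \<open>Y + 1\<close> dominates the new summand because
    \<open>(Y + 1) * (ln (Y + 1) - ln Y) \<le> 2\<close>.\<close>
  have bound: "(\<Sum>p=2..Y. ln (real p) / (real p * (real p - 1))) \<le> 4 - (ln (real Y) + 2) / real Y" if "Y \<ge> 1" for Y
    using that
  proof (induction Y rule: dec_induct)
    case (step Y)
    have Y: "real Y \<ge> 1" using step by simp
    let ?y = "real Y"
    have l: "?y * (ln (?y + 1) - ln ?y) \<le> 1" using ln_Suc_diff_le[of Y] step by (simp add: add.commute)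
    have "ln (?y + 1) / ((?y + 1) * ?y) + (ln (?y + 1) + 2) / (?y + 1) = (ln (?y+1) * (1 + ?y) + 2 * ?y) / (?y * (?y + 1))"
    proof -
      have "?y \<noteq> 0" "?y + 1 \<noteq> 0" using Y by auto
      thus ?thesis by (simp add: divide_simps) (simp add: algebra_simps)
    qed
    also have "\<dots> \<le> ((ln ?y + 2) * (?y + 1)) / (?y * (?y + 1))"
    proof (rule divide_right_mono)
      have "(ln (?y + 1) - ln ?y) * 1 \<le> (ln (?y + 1) - ln ?y) * ?y"
        using Y by (intro mult_left_mono) auto
      hence "(ln (?y + 1) - ln ?y) * (?y + 1) \<le> 2" using l by (simp add: algebra_simps)
      thus "ln (?y+1) * (1 + ?y) + 2 * ?y \<le> (ln ?y + 2) * (?y + 1)" by (simp add: algebra_simps)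
    qed (use Y in auto)
    also have "\<dots> = (ln ?y + 2) / ?y"
    proof -
      have "?y + 1 \<noteq> 0" using Y by auto
      thus ?thesis by simp
    qed
    finally have "ln (?y + 1) / ((?y + 1) * ?y) \<le> (ln ?y + 2) / ?y - (ln (?y + 1) + 2) / (?y + 1)" by simp
    moreover have "(\<Sum>p=2..Suc Y. ln (real p) / (real p * (real p - 1))) =
        (\<Sum>p=2..Y. ln (real p) / (real p * (real p - 1))) + ln (?y + 1) / ((?y + 1) * ?y)"
      using step by (simp add: add.commute)
    ultimately show ?case using step by (simp add: add.commute)
  qed simp
  show ?thesis
  proof (cases "Y \<ge> 1")
    case True
    have "(ln (real Y) + 2) / real Y \<ge> 0" using True by (intro divide_nonneg_nonneg) auto
    thus ?thesis using bound[OF True] by linarith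
  qed simp
qed

text \<open>The geometric series over the exponents \<open>k \<ge> 2\<close> gives
  \<open>ln p / (p * (p - 1))\<close>, which is summable even over all integers
  \<open>p \<ge> 2\<close>.\<close>

lemma sum_mangoldt_nonprime_le:
  "(\<Sum>n | n \<in> {1..Y} \<and> \<not> prime n. mangoldt n / real n) \<le> 4"
proof -
  have nonneg: "0 \<le> mangoldt n / real n" for n
    by (intro divide_nonneg_nonneg mangoldt_nonneg) auto
  let ?S = "{2..Y} \<times> {2..Y}"
  have geo: "(\<Sum>k=2..Y. 1 / x ^ k) \<le> 1 / (x * (x - 1))" if x: "x \<ge> 2" for x :: real
  proof -
    have "(\<Sum>k=2..Y. 1 / x ^ k) \<le> 1 / (x * (x - 1)) - (if Y \<ge> 1 then 1 / (x ^ Y * (x - 1)) else 0)"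
    proof (induction Y)
      case (Suc Y)
      show ?case
      proof (cases "Y = 0")
        case False
        have "(\<Sum>k=2..Suc Y. 1 / x ^ k) = (\<Sum>k=2..Y. 1 / x ^ k) + 1 / x ^ Suc Y" using False by simp
        moreover have "1 / (x ^ Y * (x - 1)) = 1 / x ^ Suc Y + 1 / (x ^ Suc Y * (x - 1))"
          using x by (simp add: divide_simps)
        ultimately show ?thesis using Suc False by simp
      qed (use x in simp)
    qed (use x in simp)
    moreover have "0 \<le> (if Y \<ge> 1 then 1 / (x ^ Y * (x - 1)) else 0)" using x by simp
    ultimately show ?thesis by linarith
  qed
  have "(\<Sum>n | n \<in> {1..Y} \<and> \<not> prime n. mangoldt n / real n) =
      (\<Sum>n | n \<in> {1..Y} \<and> \<not> prime n \<and> primepow n. mangoldt n / real n)"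
    by (rule sum.mono_neutral_right) (auto simp: mangoldt_def)
  also have "\<dots> \<le> (\<Sum>(p, k)\<in>?S. ln (real p) / real p ^ k)"
  proof (rule sum_le_included[where i = "\<lambda>(p, k). p ^ k"])
    show "\<forall>n\<in>{n. n \<in> {1..Y} \<and> \<not> prime n \<and> primepow n}.
        \<exists>y\<in>?S. (case y of (p, k) \<Rightarrow> p ^ k) = n \<and>
          mangoldt n / real n \<le> (case y of (p, k) \<Rightarrow> ln (real p) / real p ^ k)"
    proof
      fix n assume n: "n \<in> {n. n \<in> {1..Y} \<and> \<not> prime n \<and> primepow n}"
      then obtain p k where p: "prime p" "k > 0" "n = p ^ k" by (auto simp: primepow_def)
      have "k \<noteq> 1" using p n by auto
      hence k: "k \<ge> 2" using p by simp
      have p2: "p \<ge> 2" using p prime_ge_2_nat by blast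
      have "k < p ^ k" using p2 by (intro power_gt_expt) simp
      moreover have "p \<le> p ^ k" using p2 p by (simp add: self_le_power)
      ultimately have "(p, k) \<in> ?S" using n p p2 k by simp
      moreover have "mangoldt n / real n = ln (real p) / real p ^ k"
        using p by simp
      ultimately show "\<exists>y\<in>?S. (case y of (p, k) \<Rightarrow> p ^ k) = n \<and>
          mangoldt n / real n \<le> (case y of (p, k) \<Rightarrow> ln (real p) / real p ^ k)"
        using p by (intro bexI[of _ "(p, k)"]) auto
    qed
  qed (auto intro!: divide_nonneg_nonneg)
  also have "\<dots> = (\<Sum>p=2..Y. ln (real p) * (\<Sum>k=2..Y. 1 / real p ^ k))"
    by (subst sum.cartesian_product[symmetric]) (simp add: sum_distrib_left)
  also have "\<dots> \<le> (\<Sum>p=2..Y. ln (real p) * (1 / (real p * (real p - 1))))"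
    by (intro sum_mono mult_left_mono geo) auto
  also have "\<dots> \<le> 4" using sum_ln_over_square_le[of Y] by simp
  finally show ?thesis .
qed

lemma prime_sum_ge_mangoldt_sum:
  "(\<Sum>p | p \<in> {1..Y} \<and> prime p \<and> P p. ln (real p) / real p) \<ge>
   (\<Sum>n | n \<in> {1..Y} \<and> P n. mangoldt n / real n) - 4"
proof -
  have nonneg: "0 \<le> mangoldt n / real n" for n
    by (intro divide_nonneg_nonneg mangoldt_nonneg) auto
  have "(\<Sum>n | n \<in> {1..Y} \<and> P n. mangoldt n / real n) =
     (\<Sum>n | n \<in> {1..Y} \<and> prime n \<and> P n. mangoldt n / real n) +
     (\<Sum>n | n \<in> {1..Y} \<and> \<not> prime n \<and> P n. mangoldt n / real n)"
    by (subst sum.union_disjoint[symmetric]) (auto intro!: sum.cong)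
  also have "(\<Sum>n | n \<in> {1..Y} \<and> \<not> prime n \<and> P n. mangoldt n / real n) \<le>
     (\<Sum>n | n \<in> {1..Y} \<and> \<not> prime n. mangoldt n / real n)"
    by (rule sum_mono2) (use nonneg in auto)
  also have "\<dots> \<le> 4" by (rule sum_mangoldt_nonprime_le)
  finally show ?thesis by simp
qed

text \<open>If the gcd is \<open>3 ^ v\<close>, the congruence can hold only for
  \<open>j \<le> v\<close>, and the totients of \<open>3, ..., 3 ^ v\<close> add up to
  \<open>3 ^ v - 1\<close>. In this form the estimates for the individual progressions can be
  summed.\<close>

lemma gcd_power_of_3_ge:
  assumes "p > 1"
  shows "real (gcd (3 ^ r) (p - 1)) \<ge> 1 + (\<Sum>j=1..r. if [p = 1] (mod 3 ^ j) then real (totient (3 ^ j)) else 0)"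
proof -
  define S where "S = {j\<in>{1..r}. [p = 1] (mod 3 ^ j)}"
  have iff: "[p = 1] (mod 3 ^ j) \<longleftrightarrow> 3 ^ j dvd p - 1" for j
    using assms by (simp add: cong_altdef_nat cong_sym_eq)
  obtain v where v: "v \<le> r" "gcd (3 ^ r) (p - 1) = 3 ^ v"
    using divides_primepow_nat[of 3 "gcd (3 ^ r) (p - 1)" r] by auto
  have "S \<subseteq> {1..v}"
  proof
    fix j assume j: "j \<in> S"
    hence "3 ^ j dvd p - 1" "j \<le> r" using iff[of j] unfolding S_def by simp_all
    hence "3 ^ j dvd gcd (3 ^ r) (p - 1)" by (simp add: le_imp_power_dvd)
    hence "(3::nat) ^ j dvd 3 ^ v" unfolding v(2) .
    hence "j \<le> v" by (simp add: power_dvd_imp_le)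
    thus "j \<in> {1..v}" using j by (simp add: S_def)
  qed
  have "(\<Sum>j=1..r. if [p = 1] (mod 3 ^ j) then real (totient (3 ^ j)) else 0) = (\<Sum>j\<in>S. real (totient (3 ^ j)))"
    unfolding S_def by (subst sum.inter_filter[symmetric]) auto
  also have "\<dots> \<le> (\<Sum>j=1..v. real (totient (3 ^ j)))"
    using \<open>S \<subseteq> {1..v}\<close> by (intro sum_mono2) auto
  also have "\<dots> = 3 ^ v - 1"
  proof (induction v)
    case (Suc v)
    have "totient (3 ^ Suc v) = 3 ^ v * 2" by (subst totient_prime_power_Suc) auto
    thus ?case using Suc by simp
  qed simp
  finally show ?thesis using v by simp
qed

text \<open>Averaging over \<open>L = 3\<^sup>r l\<close> with \<open>l \<le> Y\<close>: each prime \<open>p \<le> Y\<close> divides the product for about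
  \<open>Y gcd(3\<^sup>r, p - 1) / p\<close> values of \<open>l\<close>, and \<open>gcd(3\<^sup>r, p - 1)\<close> is \<open>r + 1\<close> on average.\<close>

lemma ex_large_log_prime_sum:
  "\<exists>C. \<forall>Y>0. \<exists>l\<in>{1..Y}. (\<Sum>p | prime p \<and> p - 1 dvd 3 ^ r * l. ln (real p)) \<ge> real (r + 1) * ln (real Y) - C"
proof -
  have "\<exists>B. \<forall>j>0. \<forall>X>0. real (totient (3 ^ j)) *
     (\<Sum>n | n \<in> {1..X} \<and> [n = 1] (mod 3 ^ j). mangoldt n / real n) \<ge> ln (real X) - B j"
    using mangoldt_progression_power_of_3 by metis
  then obtain B where B: "\<And>j X. j > 0 \<Longrightarrow> X > 0 \<Longrightarrow> real (totient (3 ^ j)) *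
     (\<Sum>n | n \<in> {1..X} \<and> [n = 1] (mod 3 ^ j). mangoldt n / real n) \<ge> ln (real X) - B j" by blast
  \<comment> \<open>The 5 consists of 1 from Mertens' bound and 4 from the prime powers in the sum
    over all primes; each progression costs \<open>B j\<close> and 4 times its totient.\<close>
  define D where "D = 5 + (\<Sum>j=1..r. B j + 4 * real (totient (3 ^ j)))"
  define M :: nat where "M = 3 ^ r"
  have Mpos: "M > 0" by (simp add: M_def)
  have "\<exists>l\<in>{1..Y}. (\<Sum>p | prime p \<and> p - 1 dvd M * l. ln (real p)) \<ge> real (r + 1) * ln (real Y) - (D + 4)"
    if Y: "Y > 0" for Y
  proof (rule ccontr)
    assume "\<not> ?thesis"
    hence less: "(\<Sum>p | prime p \<and> p - 1 dvd M * l. ln (real p)) < real (r + 1) * ln (real Y) - (D + 4)"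
      if "l \<in> {1..Y}" for l using that by force
    define P where "P = {p. p \<in> {1..Y} \<and> prime p}"
    have finP: "finite P" unfolding P_def by simp
    define G where "G = (\<lambda>p. gcd M (p - 1))"
    \<comment> \<open>Each of the \<open>r + 1\<close> summands in the lower bound for the gcd
      contributes \<open>ln Y\<close> up to a constant.\<close>
    have main: "(\<Sum>p\<in>P. real (G p) * (ln (real p) / real p)) \<ge> real (r + 1) * ln (real Y) - D"
    proof -
      have "(\<Sum>p\<in>P. ln (real p) / real p) + (\<Sum>j=1..r. real (totient (3 ^ j)) *
            (\<Sum>p | p \<in> {1..Y} \<and> prime p \<and> [p = 1] (mod 3 ^ j). ln (real p) / real p)) =
          (\<Sum>p\<in>P. (1 + (\<Sum>j=1..r. if [p = 1] (mod 3 ^ j) then real (totient (3 ^ j)) else 0)) * (ln (real p) / real p))"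
      proof -
        have "(\<Sum>p | p \<in> {1..Y} \<and> prime p \<and> [p = 1] (mod 3 ^ j). ln (real p) / real p) =
          (\<Sum>p\<in>P. if [p = 1] (mod 3 ^ j) then ln (real p) / real p else 0)" for j
          using finP by (subst sum.inter_filter[symmetric]) (auto simp: P_def intro!: sum.cong)
        hence "(\<Sum>j=1..r. real (totient (3 ^ j)) *
            (\<Sum>p | p \<in> {1..Y} \<and> prime p \<and> [p = 1] (mod 3 ^ j). ln (real p) / real p)) =
          (\<Sum>j=1..r. \<Sum>p\<in>P. (if [p = 1] (mod 3 ^ j) then real (totient (3 ^ j)) else 0) * (ln (real p) / real p))"
          by (auto simp: sum_distrib_left intro!: sum.cong)
        also have "\<dots> = (\<Sum>p\<in>P. \<Sum>j=1..r. (if [p = 1] (mod 3 ^ j) then real (totient (3 ^ j)) else 0) * (ln (real p) / real p))"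
          by (rule sum.swap)
        finally show ?thesis by (simp only: distrib_right sum.distrib sum_distrib_right mult_1)
      qed
      also have "\<dots> \<le> (\<Sum>p\<in>P. real (G p) * (ln (real p) / real p))"
        unfolding G_def M_def
        by (intro sum_mono mult_right_mono gcd_power_of_3_ge) (auto simp: P_def prime_gt_Suc_0_nat intro!: divide_nonneg_nonneg)
      finally have 1: "(\<Sum>p\<in>P. ln (real p) / real p) + (\<Sum>j=1..r. real (totient (3 ^ j)) *
            (\<Sum>p | p \<in> {1..Y} \<and> prime p \<and> [p = 1] (mod 3 ^ j). ln (real p) / real p)) \<le>
          (\<Sum>p\<in>P. real (G p) * (ln (real p) / real p))" .
      have 2: "(\<Sum>p\<in>P. ln (real p) / real p) \<ge> ln (real Y) - 5"
        using prime_sum_ge_mangoldt_sum[where P = "\<lambda>_. True" and Y = Y] mertens_lower[OF Y]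
        by (simp add: P_def del: atLeastAtMost_iff)
      have "(\<Sum>j=1..r. ln (real Y) - (B j + 4 * real (totient (3 ^ j)))) \<le> (\<Sum>j=1..r. real (totient (3 ^ j)) *
            (\<Sum>p | p \<in> {1..Y} \<and> prime p \<and> [p = 1] (mod 3 ^ j). ln (real p) / real p))"
      proof (rule sum_mono)
        fix j assume j: "j \<in> {1..r}"
        have "real (totient (3 ^ j)) * (\<Sum>p | p \<in> {1..Y} \<and> prime p \<and> [p = 1] (mod 3 ^ j). ln (real p) / real p)
          \<ge> real (totient (3 ^ j)) * ((\<Sum>n | n \<in> {1..Y} \<and> [n = 1] (mod 3 ^ j). mangoldt n / real n) - 4)"
          by (intro mult_left_mono prime_sum_ge_mangoldt_sum) auto
        thus "ln (real Y) - (B j + 4 * real (totient (3 ^ j))) \<le> real (totient (3 ^ j)) *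
            (\<Sum>p | p \<in> {1..Y} \<and> prime p \<and> [p = 1] (mod 3 ^ j). ln (real p) / real p)"
          using B[of j Y] j Y by (simp add: right_diff_distrib)
      qed
      hence "real r * ln (real Y) - (\<Sum>j=1..r. B j + 4 * real (totient (3 ^ j))) \<le> (\<Sum>j=1..r. real (totient (3 ^ j)) *
            (\<Sum>p | p \<in> {1..Y} \<and> prime p \<and> [p = 1] (mod 3 ^ j). ln (real p) / real p))"
        by (simp only: sum_subtractf sum_constant card_atLeastAtMost) simp
      thus ?thesis using 1 2 unfolding D_def by (simp add: distrib_right)
    qed
    \<comment> \<open>With \<open>s = (p - 1) div G p\<close>, every multiple \<open>l\<close> of
      \<open>s\<close> satisfies \<open>p - 1 dvd M * l\<close>, and
      \<open>s * G p \<le> p\<close>.\<close>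
    have count: "real (card {l\<in>{1..Y}. p - 1 dvd M * l}) \<ge> real Y * real (G p) / real p - 1" if p: "p \<in> P" for p
    proof -
      have p2: "p \<ge> 2" using p prime_ge_2_nat by (auto simp: P_def)
      define s where "s = (p - 1) div G p"
      have ps: "p - 1 = s * G p" by (simp add: s_def G_def)
      have Gpos: "G p > 0" using Mpos by (simp add: G_def)
      have spos: "s > 0" using ps p2 by (cases s) auto
      have "(\<lambda>i. s * i) ` {1..Y div s} \<subseteq> {l\<in>{1..Y}. p - 1 dvd M * l}"
      proof
        fix l assume "l \<in> (\<lambda>i. s * i) ` {1..Y div s}"
        then obtain i where i: "l = s * i" "i \<ge> 1" "i \<le> Y div s" by (metis atLeastAtMost_iff imageE)
        have le: "s * i \<le> Y" using i(3) spos by (simp add: less_eq_div_iff_mult_less_eq mult.commute)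
        have "s * G p dvd s * i * M"
          by (simp add: G_def mult.assoc dvd_mult)
        hence "p - 1 dvd M * l" unfolding ps i(1) by (simp only: mult_ac)
        thus "l \<in> {l\<in>{1..Y}. p - 1 dvd M * l}"
          using le i spos by (simp add: Suc_le_eq)
      qed
      hence "card ((\<lambda>i. s * i) ` {1..Y div s}) \<le> card {l\<in>{1..Y}. p - 1 dvd M * l}"
        by (intro card_mono) auto
      moreover have "card ((\<lambda>i. s * i) ` {1..Y div s}) = Y div s"
        using spos by (subst card_image) (auto simp: inj_on_def)
      ultimately have "real (Y div s) \<le> real (card {l\<in>{1..Y}. p - 1 dvd M * l})" by simp
      moreover have "real Y / real s - 1 \<le> real (Y div s)" by (rule div_bounds_real[OF spos])
      moreover have "real Y * real (G p) / real p \<le> real Y / real s"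
      proof -
        have "real (s * G p) \<le> real p" using ps p2 by (metis diff_le_self of_nat_le_iff)
        hence "real Y * (real s * real (G p)) \<le> real Y * real p" by (intro mult_left_mono) auto
        thus ?thesis using spos p2 by (simp add: divide_simps mult_ac)
      qed
      ultimately show ?thesis by linarith
    qed
    have fin: "finite {p. prime p \<and> p - 1 dvd M * l}" if "l \<in> {1..Y}" for l
    proof (rule finite_subset)
      show "{p. prime p \<and> p - 1 dvd M * l} \<subseteq> {..Suc (M * l)}"
        using that Mpos by (auto dest!: dvd_imp_le)
    qed simp
    \<comment> \<open>Summing \<open>less\<close> over all \<open>l \<le> Y\<close> and exchanging
      the sums contradicts \<open>main\<close>. The 4 in \<open>D + 4\<close> absorbs the
      \<open>- 1\<close> of \<open>count\<close>, weighted by \<open>ln p\<close>, through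
      Chebyshev's bound.\<close>
    have "real Y * (real (r + 1) * ln (real Y) - D) - 4 * real Y \<le>
        real Y * (\<Sum>p\<in>P. real (G p) * (ln (real p) / real p)) - (\<Sum>p\<in>P. ln (real p))"
    proof (intro diff_mono mult_left_mono main)
      have "(\<Sum>p\<in>P. ln (real p)) = (\<Sum>p\<in>P. mangoldt p)" by (intro sum.cong) (auto simp: P_def)
      also have "\<dots> \<le> (\<Sum>p=1..Y. mangoldt p)"
        by (intro sum_mono2) (auto simp: P_def mangoldt_nonneg)
      also have "\<dots> \<le> 4 * real Y" by (rule psi_le)
      finally show "(\<Sum>p\<in>P. ln (real p)) \<le> 4 * real Y" .
    qed auto
    also have "\<dots> = (\<Sum>p\<in>P. (real Y * real (G p) / real p - 1) * ln (real p))"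
      by (simp add: sum_distrib_left sum_subtractf algebra_simps)
    also have "\<dots> \<le> (\<Sum>p\<in>P. real (card {l\<in>{1..Y}. p - 1 dvd M * l}) * ln (real p))"
      by (intro sum_mono mult_right_mono count) (auto simp: P_def)
    also have "\<dots> = (\<Sum>p\<in>P. \<Sum>l=1..Y. if p - 1 dvd M * l then ln (real p) else 0)"
      by (intro sum.cong refl) (simp add: sum.inter_filter[symmetric])
    also have "\<dots> = (\<Sum>l=1..Y. \<Sum>p\<in>P. if p - 1 dvd M * l then ln (real p) else 0)"
      by (rule sum.swap)
    also have "\<dots> = (\<Sum>l=1..Y. \<Sum>p | p \<in> P \<and> p - 1 dvd M * l. ln (real p))"
      by (rule sum.cong[OF refl]) (simp add: sum.inter_filter finP)
    also have "\<dots> \<le> (\<Sum>l=1..Y. \<Sum>p | prime p \<and> p - 1 dvd M * l. ln (real p))"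
      by (intro sum_mono sum_mono2 fin) (auto simp: P_def prime_gt_0_nat Suc_le_eq)
    also have "\<dots> < (\<Sum>l=1..Y. real (r + 1) * ln (real Y) - (D + 4))"
      using Y by (intro sum_strict_mono less) auto
    also have "\<dots> = real Y * (real (r + 1) * ln (real Y) - D) - 4 * real Y"
      by (simp add: algebra_simps)
    finally show False by simp
  qed
  thus ?thesis unfolding M_def by blast
qed

text \<open>With \<open>r = K\<close> the product is at least \<open>exp (- C) * Y ^ (K + 1)\<close>
  for some \<open>L \<le> 3 ^ K * Y\<close>; the additional factor \<open>Y\<close> beats any
  constant.\<close>

lemma ex_large_prime_product:
  fixes c :: real
  shows "\<exists>L>0. real (\<Prod>{p. prime p \<and> p - 1 dvd L}) > c * real L ^ K"
proof -
  obtain C where C: "\<And>Y. Y > 0 \<Longrightarrow> \<exists>l\<in>{1..Y}. (\<Sum>p | prime p \<and> p - 1 dvd 3 ^ K * l. ln (real p)) \<ge> real (K + 1) * ln (real Y) - C"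
    using ex_large_log_prime_sum[of K] by blast
  define M :: nat where "M = 3 ^ K"
  have M: "M > 0" by (simp add: M_def)
  obtain Y0 :: nat where Y0: "\<bar>c\<bar> * real M ^ K * exp C < real Y0" using reals_Archimedean2 by blast
  define Y where "Y = Suc Y0"
  have Y: "Y > 0" "\<bar>c\<bar> * real M ^ K * exp C < real Y" using Y0 by (auto simp: Y_def)
  obtain l where l: "l \<in> {1..Y}" and
    sum: "(\<Sum>p | prime p \<and> p - 1 dvd M * l. ln (real p)) \<ge> real (K + 1) * ln (real Y) - C"
    using C[OF Y(1)] unfolding M_def by blast
  define L where "L = M * l"
  have L: "L > 0" using M l by (simp add: L_def)
  let ?P = "{p. prime p \<and> p - 1 dvd L}"
  have "finite ?P"
    by (rule finite_subset[of _ "{..Suc L}"]) (use L in \<open>auto dest!: dvd_imp_le\<close>)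
  have "c * real L ^ K \<le> \<bar>c\<bar> * real L ^ K" by (intro mult_right_mono) auto
  also have "\<dots> \<le> \<bar>c\<bar> * (real M * real Y) ^ K"
    using l by (intro mult_left_mono power_mono) (auto simp: L_def mult_left_mono)
  also have "\<dots> = (\<bar>c\<bar> * real M ^ K * exp C) * real Y ^ K * exp (- C)"
    by (simp add: power_mult_distrib exp_minus field_simps)
  also have "\<dots> < real Y * real Y ^ K * exp (- C)"
    using Y by (intro mult_strict_right_mono) auto
  also have "\<dots> = exp (real (K + 1) * ln (real Y) - C)"
    using Y(1) by (simp add: exp_diff exp_minus exp_of_nat_mult divide_inverse del: of_nat_add of_nat_Suc)
  also have "\<dots> \<le> exp (\<Sum>p\<in>?P. ln (real p))" using sum by (simp add: L_def)
  also have "\<dots> = (\<Prod>p\<in>?P. exp (ln (real p)))" by (rule exp_sum) fact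
  also have "\<dots> = (\<Prod>p\<in>?P. real p)" by (intro prod.cong) (auto simp: prime_gt_0_nat)
  also have "\<dots> = real (\<Prod>?P)" by simp
  finally show ?thesis using L by blast
qed

section \<open>Residues of signed sums modulo a product of primes\<close>

lemma prod_primes_dvd:
  fixes n :: nat
  assumes "finite S" "\<And>p. p \<in> S \<Longrightarrow> prime p" "\<And>p. p \<in> S \<Longrightarrow> p dvd n"
  shows "\<Prod>S dvd n"
  using assms
proof (induction S rule: finite_induct)
  case (insert p S)
  have "coprime p (\<Prod>S)"
  proof (rule prod_coprime_right)
    fix r assume "r \<in> S"
    thus "coprime p r" using insert by (intro primes_coprime) auto
  qed
  thus ?case using insert by (simp add: divides_mult)
qed simp

lemma sum_list_mod_int: "sum_list (map (\<lambda>x. x mod m) xs) mod m = sum_list xs mod (m :: int)"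
proof (induction xs)
  case (Cons x xs)
  have "(x mod m + sum_list (map (\<lambda>x. x mod m) xs)) mod m = (x + sum_list xs) mod m"
    using Cons by (metis mod_add_eq mod_mod_trivial)
  thus ?case by simp
qed simp

lemma card_signed_sums_mod_le:
  fixes m :: int
  assumes fin: "finite R" and R0: "0 \<in> R" and R: "\<And>x. x \<in> E \<union> uminus ` E \<Longrightarrow> x mod m \<in> R"
  shows "card ((\<lambda>x. x mod m) ` signed_sums E K) \<le> card R ^ K"
proof -
  let ?Ls = "{xs. set xs \<subseteq> R \<and> length xs = K}"
  have "(\<lambda>x. x mod m) ` signed_sums E K \<subseteq> (\<lambda>xs. sum_list xs mod m) ` ?Ls"
  proof
    fix y assume "y \<in> (\<lambda>x. x mod m) ` signed_sums E K"
    then obtain xs where xs: "y = sum_list xs mod m" "length xs \<le> K" "set xs \<subseteq> E \<union> uminus ` E"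
      by (auto simp: signed_sums_def)
    \<comment> \<open>Padding with 0, an element of \<open>R\<close>, gives lists of length exactly
      \<open>K\<close>, hence the count \<open>card R ^ K\<close>.\<close>
    define ys where "ys = map (\<lambda>x. x mod m) xs @ replicate (K - length xs) 0"
    have "ys \<in> ?Ls" using xs R R0 by (auto simp: ys_def)
    moreover have "sum_list ys mod m = y" using xs by (simp add: ys_def sum_list_replicate sum_list_mod_int)
    ultimately show "y \<in> (\<lambda>xs. sum_list xs mod m) ` ?Ls" by blast
  qed
  hence "card ((\<lambda>x. x mod m) ` signed_sums E K) \<le> card ((\<lambda>xs. sum_list xs mod m) ` ?Ls)"
    using fin by (intro card_mono finite_imageI finite_lists_length_eq)
  also have "\<dots> \<le> card ?Ls" using fin by (intro card_image_le finite_lists_length_eq)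
  also have "\<dots> = card R ^ K" using fin by (rule card_lists_length_eq)
  finally show ?thesis .
qed

text \<open>A modulus \<open>m\<close> is found for which the signed sums have fewer than
  \<open>m\<close> residues: by Fermat's theorem each base satisfies \<open>a ^ L = 1\<close> modulo
  \<open>m\<close>, so its powers have at most \<open>L\<close> residues, and so do their
  negatives.\<close>

lemma signed_sums_powers_neq_UNIV:
  fixes as :: "int list"
  assumes as: "\<forall>a\<in>set as. a > 1"
  shows "signed_sums (\<Union>a\<in>set as. powers a) K \<noteq> UNIV"
proof
  assume UNIV: "signed_sums (\<Union>a\<in>set as. powers a) K = UNIV"
  define E where "E = (\<Union>a\<in>set as. powers a)"
  define A where "A = (\<Prod>a\<in>set as. nat a)"
  define n where "n = card (set as)"
  have A: "A > 0" using as unfolding A_def by (intro prod_pos) auto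
  \<comment> \<open>The factor \<open>A\<close> compensates for the primes dividing a base, which
    are left out of \<open>m\<close>; the factor \<open>2 * n + 1\<close> allows for 0 and for both
    signs in \<open>R\<close>.\<close>
  obtain L where L: "L > 0" and
    big: "real (\<Prod>{p. prime p \<and> p - 1 dvd L}) > real (A * (2 * n + 1) ^ K) * real L ^ K"
    using ex_large_prime_product by blast
  define P where "P = {p. prime p \<and> p - 1 dvd L}"
  have finP: "finite P" unfolding P_def
    by (rule finite_subset[of _ "{..Suc L}"]) (use L in \<open>auto dest!: dvd_imp_le\<close>)
  define m where "m = \<Prod>{p\<in>P. \<not> p dvd A}"
  have "\<Prod>P = m * \<Prod>{p\<in>P. p dvd A}"
    unfolding m_def by (subst prod.union_disjoint[symmetric]) (use finP in \<open>auto intro!: prod.cong\<close>)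
  moreover have "\<Prod>{p\<in>P. p dvd A} \<le> A"
    using A finP by (intro dvd_imp_le prod_primes_dvd) (auto simp: P_def)
  ultimately have "\<Prod>P \<le> m * A" by simp
  moreover have "A * (2 * n + 1) ^ K * L ^ K < \<Prod>P"
    using big unfolding P_def by (metis of_nat_less_iff of_nat_mult of_nat_power)
  ultimately have "A * (2 * n + 1) ^ K * L ^ K < m * A" by (rule less_le_trans[rotated])
  hence "A * ((2 * n + 1) ^ K * L ^ K) < A * m" by (simp only: mult_ac)
  hence m_big: "((2 * n + 1) * L) ^ K < m" unfolding power_mult_distrib using A by (simp only: mult_less_cancel1)
  hence mpos: "m > 0" by linarith
  have period: "[a ^ L = 1] (mod int m)" if a: "a \<in> set as" for a
  proof -
    define b where "b = nat a"
    have ab: "a = int b" "b > 1" using as a by (auto simp: b_def)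
    have "b dvd A" unfolding A_def b_def using a by (intro dvd_prodI) auto
    have "m dvd b ^ L - 1" unfolding m_def
    proof (rule prod_primes_dvd)
      fix p assume p: "p \<in> {p\<in>P. \<not> p dvd A}"
      hence pp: "prime p" "p - 1 dvd L" "\<not> p dvd b" using \<open>b dvd A\<close> by (auto simp: P_def intro: dvd_trans)
      then obtain k where k: "L = (p - 1) * k" by (elim dvdE)
      have "[b ^ (p - 1) = 1] (mod p)" using pp by (intro fermat_theorem)
      hence "[(b ^ (p - 1)) ^ k = 1 ^ k] (mod p)" by (rule cong_pow)
      hence "[b ^ L = 1] (mod p)" by (simp add: k power_mult)
      thus "p dvd b ^ L - 1" by (rule cong_to_1_nat)
    next
      show "prime p" if "p \<in> {p\<in>P. \<not> p dvd A}" for p using that by (simp add: P_def)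
    qed (use finP in simp)
    hence "[b ^ L = 1] (mod m)" using ab by (subst cong_altdef_nat) auto
    hence "[int (b ^ L) = int 1] (mod int m)" by (simp only: cong_int_iff)
    thus ?thesis by (simp add: ab)
  qed
  define R where "R = {0} \<union> (\<lambda>(a, i). a ^ i mod int m) ` (set as \<times> {..<L}) \<union>
      (\<lambda>(a, i). (- (a ^ i)) mod int m) ` (set as \<times> {..<L})"
  have finR: "finite R" by (simp add: R_def)
  have "card R \<le> (1 + n * L) + n * L" unfolding R_def n_def
    by (intro order.trans[OF card_Un_le] add_mono order.trans[OF card_image_le]) auto
  hence "card R \<le> 1 + 2 * n * L" by simp
  also have "\<dots> \<le> (2 * n + 1) * L" using L by (simp add: algebra_simps)
  finally have cardR: "card R \<le> (2 * n + 1) * L" .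
  have pow: "\<exists>i<L. [a ^ k = a ^ i] (mod int m)" if a: "a \<in> set as" for a k
  proof -
    have "a ^ k = (a ^ L) ^ (k div L) * a ^ (k mod L)"
      by (simp add: power_mult[symmetric] power_add[symmetric])
    moreover have "[(a ^ L) ^ (k div L) * a ^ (k mod L) = 1 ^ (k div L) * a ^ (k mod L)] (mod int m)"
      using period[OF a] by (intro cong_mult cong_pow cong_refl)
    ultimately show ?thesis using L by (intro exI[of _ "k mod L"]) simp
  qed
  have "x mod int m \<in> R" if x: "x \<in> E \<union> uminus ` E" for x
  proof -
    obtain a k where a: "a \<in> set as" and ak: "x = a ^ k \<or> x = - (a ^ k)"
      using x by (auto simp: E_def powers_def)
    obtain i where i: "i < L" "[a ^ k = a ^ i] (mod int m)" using pow[OF a] by blast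
    have "[- (a ^ k) = - (a ^ i)] (mod int m)" using i by (simp add: cong_minus_minus_iff)
    hence "x mod int m = a ^ i mod int m \<or> x mod int m = (- (a ^ i)) mod int m"
      using ak i by (auto simp: cong_def)
    thus ?thesis using a i by (force simp: R_def)
  qed
  hence "card ((\<lambda>x. x mod int m) ` signed_sums E K) \<le> card R ^ K"
    by (intro card_signed_sums_mod_le finR) (auto simp: R_def)
  also have "\<dots> \<le> ((2 * n + 1) * L) ^ K" using cardR by (intro power_mono) auto
  also have "\<dots> < m" by (rule m_big)
  finally have "card ((\<lambda>x. x mod int m) ` (UNIV :: int set)) < m" using UNIV by (simp add: E_def)
  moreover have "{0..<int m} \<subseteq> (\<lambda>x. x mod int m) ` UNIV"
  proof
    fix y assume "y \<in> {0..<int m}"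
    hence "y = y mod int m" by simp
    thus "y \<in> range (\<lambda>x. x mod int m)" by (rule range_eqI)
  qed
  moreover have "finite ((\<lambda>x. x mod int m) ` (UNIV :: int set))"
    by (rule finite_subset[of _ "{0..<int m}"]) (use mpos in auto)
  ultimately have "card {0..<int m} < m" by (meson card_mono order.strict_trans1)
  thus False by simp
qed

theorem theoremA:
  fixes as :: "int list"
  assumes "\<forall>a\<in>set as. a > 1"
  shows "\<not> definable_binary_fun (map powers as) (\<lambda>x y. x * y)"
proof (rule mult_not_definable)
  \<comment> \<open>The base 2 is adjoined so that \<open>?E\<close> contains 1 and is unbounded
    even for an empty list; the predicates remain those of \<open>as\<close>.\<close>
  let ?E = "\<Union>a\<in>set (2 # as). powers a"
  show "1 \<in> ?E" by (force simp: powers_def intro: exI[of _ 0])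
  show "\<exists>y\<in>?E. b \<le> y" for b
  proof -
    have "b \<le> int (nat b)" by simp
    also have "nat b < 2 ^ nat b" by simp
    hence "int (nat b) \<le> int (2 ^ nat b)" by linarith
    finally have "b \<le> 2 ^ nat b" by simp
    moreover have "2 ^ nat b \<in> ?E" by (auto simp: powers_def)
    ultimately show ?thesis by blast
  qed
  show "P \<subseteq> ?E" if "P \<in> set (map powers as)" for P using that by auto
  show "signed_sums ?E K \<noteq> UNIV" for K
    using assms by (intro signed_sums_powers_neq_UNIV) auto
qed

end
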